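(* Let $\mu\in\mathcal{D}$, and let $u^{*,k}$ and $u_N^{*,k}$, $k\in\mathbb{K}$, be the optimal controls (model errors) of the full-order weak-constraint 4D-Var problem (FE) and the reduced-order weak-constraint 4D-Var problem (RB), respectively, both defined in the context. Then for every $\mu\in\mathcal{D}$ $$\Big(\tau\sum_{k=1}^K\|u^{*,k}-u_N^{*,k}\|_U^2\Big)^{1/2}\;\le\;\tilde\Delta_N^u(\mu):=c_1(\mu)+\sqrt{c_1(\mu)^2+c_2(\mu)},$$ where $$c_1(\mu)=\frac12\left(\tilde R_u+\frac{\sqrt2\,\gamma_b}{\alpha_{\rm LB}(\mu)}\tilde R_p\right),\qquad c_2(\mu)=\frac{2\sqrt2}{\alpha_{\rm LB}(\mu)}\tilde R_y\tilde R_p+\frac{\gamma_c^2}{2(\alpha_{\rm LB}(\mu))^2}\tilde R_y^2 .$$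
   Context: Setting. $\Omega\subset\mathbb{R}^d$ is a bounded Lipschitz domain. $Y_{\rm e}$ is a Hilbert space with $H^1_0(\Omega)\subset Y_{\rm e}\subset H^1(\Omega)$, inner product $(\cdot,\cdot)_Y$ and induced norm $\|\cdot\|_Y$ equivalent to the $H^1(\Omega)$-norm. $U_{\rm e}=L^2(\Omega)$ is a Hilbert space with its inner product $(\cdot,\cdot)_U$ and induced norm $\|\cdot\|_U$. $Y\subset Y_{\rm e}$ and $U\subset U_{\rm e}$ are finite-dimensional subspaces (finite element spaces) with the inherited inner products and norms; $Y'$, $U'$ are their duals with dual norms $\|r\|_{Y'}=\sup_{v\in Y\setminus\{0\}}r(v)/\|v\|_Y$, and similarly for $U'$. $\mathcal{D}\subset\mathbb{R}^P$ is a compact parameter set. $T>0$, $K\in\mathbb{N}$, $\tau=T/K$, $\mathbb{K}=\{1,\dots,K\}$. Forms. $m(w,v)=(w,v)_{L^2(\Omega)}$. $b(\cdot,\cdot):U\times Y\to\mathbb{R}$ is a continuous bilinear form with $\gamma_b=\sup_{w\in U\setminus\{0\}}\sup_{v\in Y\setminus\{0\}}\frac{b(w,v)}{\|w\|_U\|v\|_Y}<\infty$. For each $\mu\in\mathcal{D}$, $a(\cdot,\cdot;\mu):Y\times Y\to\mathbb{R}$ is a continuous bilinear form (not necessarily symmetric), coercive with $\alpha(\mu)=\inf_{v\in Y\setminus\{0\}}a(v,v;\mu)/\|v\|_Y^2\ge\underline{\alpha}>0$ for all $\mu\in\mathcal{D}$, and affine in the parameter: $a(w,v;\mu)=\sum_{q=1}^{Q_a}\Theta_a^q(\mu)a^q(w,v)$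 with continuous $\Theta_a^q:\mathcal{D}\to\mathbb{R}$ and continuous parameter-independent bilinear forms $a^q$. $f:Y\to\mathbb{R}$ is a continuous linear functional. $D=\mathbb{R}^\ell$ with an inner product $(\cdot,\cdot)_D$ and norm $\|\cdot\|_D$; $C:Y\to D$ is the linear operator $C\phi=(h_1(\phi),\dots,h_\ell(\phi))^T$ with $h_i\in Y'$, and $\gamma_c=\sup_{v\in Y\setminus\{0\}}\|Cv\|_D/\|v\|_Y$. A lower bound $\alpha_{\rm LB}:\mathcal{D}\to\mathbb{R}_+$ is given with $0<\underline{\alpha}\le\alpha_{\rm LB}(\mu)\le\alpha(\mu)$. Data: $u_d^k\in U$ and $z_d^k\in D$, $k\in\mathbb{K}$, and a known initial condition $y_0$. Full-order problem (FE). Minimize $J(y,u;\mu)=\frac\tau2\sum_{k=1}^K\|u^k-u_d^k\|_U^2+\frac\tau2\sum_{k=1}^K\|Cy^k-z_d^k\|_D^2$ over $u\in U^K$, $y\in Y^K$, subject to $m(y^k,v)+\tau a(y^k,v;\mu)=m(y^{k-1},v)+\tau b(u^k,v)+\tau f(v)$ for all $v\in Y$, $k\in\mathbb{K}$, with $m(y^0,v)=m(y_0,v)$ for all $v\in Y$. The optimal solution is characterized by the first-order optimality system: $(y^*,p^*,u^* )\in Y^K\times Y^K\times U^K$ satisfies - $m(y^{*,k}-y^{*,k-1},\phi)+\tau a(y^{*,k},\phi;\mu)=\tau b(u^{*,k},\phi)+\tau f(\phi)$ for all $\phi\in Y$, $k\in\mathbb{K}$, and $m(y^{*,0},\phi)=m(y_0,\phi)$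 for all $\phi\in Y$; - $m(\varphi,p^{*,k}-p^{*,k+1})+\tau a(\varphi,p^{*,k};\mu)=\tau(z_d^k-Cy^{*,k},C\varphi)_D$ for all $\varphi\in Y$, $k\in\mathbb{K}$, with $p^{*,K+1}=0$; - $\tau(u^{*,k}-u_d^k,\psi)_U-\tau b(\psi,p^{*,k})=0$ for all $\psi\in U$, $k\in\mathbb{K}$. Reduced-order problem (RB). $Y_N\subset Y$ and $U_N\subset U$ are given linear subspaces (reduced basis spaces), with $y_0\in Y_N$. Minimize $J(y_N,u_N;\mu)$ over $u_N\in U_N^K$, $y_N\in Y_N^K$ subject to $m(y_N^k,v)+\tau a(y_N^k,v;\mu)=m(y_N^{k-1},v)+\tau b(u_N^k,v)+\tau f(v)$ for all $v\in Y_N$, $k\in\mathbb{K}$, with $m(y_N^0,v)=m(y_0,v)$ for all $v\in Y_N$. Its optimal solution $(y_N^*,p_N^*,u_N^* )\in Y_N^K\times Y_N^K\times U_N^K$ satisfies the reduced-order optimality system - $m(y_N^{*,k}-y_N^{*,k-1},\phi)+\tau a(y_N^{*,k},\phi;\mu)=\tau b(u_N^{*,k},\phi)+\tau f(\phi)$ for all $\phi\in Y_N$, $k\in\mathbb{K}$, and $m(y_N^{*,0},\phi)=m(y_0,\phi)$ for all $\phi\in Y_N$; - $m(\varphi,p_N^{*,k}-p_N^{*,k+1})+\tau a(\varphi,p_N^{*,k};\mu)=\tau(z_d^k-Cy_N^{*,k},C\varphi)_D$ for all $\varphi\in Y_N$, $k\in\mathbb{K}$, with $p_N^{*,K+1}=0$;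 - $\tau(u_N^{*,k}-u_d^k,\psi)_U-\tau b(\psi,p_N^{*,k})=0$ for all $\psi\in U_N$, $k\in\mathbb{K}$. Residuals. For $k\in\mathbb{K}$, $\phi,\varphi\in Y$, $\psi\in U$: $\tilde r_y^k(\phi;\mu)=f(\phi)+b(u_N^{*,k},\phi)-a(y_N^{*,k},\phi;\mu)-\frac1\tau m(y_N^{*,k}-y_N^{*,k-1},\phi)$, $\tilde r_p^k(\varphi;\mu)=(z_d^k-Cy_N^{*,k},C\varphi)_D-a(\varphi,p_N^{*,k};\mu)-\frac1\tau m(\varphi,p_N^{*,k}-p_N^{*,k+1})$, $\tilde r_u^k(\psi;\mu)=b(\psi,p_N^{*,k})-(u_N^{*,k}-u_d^k,\psi)_U$. Set $\tilde R_y=\big(\tau\sum_{k=1}^K\|\tilde r_y^k(\cdot;\mu)\|_{Y'}^2\big)^{1/2}$, $\tilde R_p=\big(\tau\sum_{k=1}^K\|\tilde r_p^k(\cdot;\mu)\|_{Y'}^2\big)^{1/2}$, $\tilde R_u=\big(\tau\sum_{k=1}^K\|\tilde r_u^k(\cdot;\mu)\|_{U'}^2\big)^{1/2}$. *)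

theory Defs
  imports "HOL-Analysis.Analysis"
begin

section \<open>Square-integrable functions modulo almost everywhere equality\<close>

definition square_integrable :: "(real ^ 'd \<Rightarrow> real) \<Rightarrow> bool" where
  "square_integrable f \<longleftrightarrow> f \<in> borel_measurable lborel \<and> integrable lborel (\<lambda>x. (f x)\<^sup>2)"

definition L2_rel :: "(real ^ 'd \<Rightarrow> real) \<Rightarrow> (real ^ 'd \<Rightarrow> real) \<Rightarrow> bool" where
  "L2_rel f g \<longleftrightarrow> square_integrable f \<and> square_integrable g \<and> (AE x in lborel. f x = g x)"

lemma square_integrable_zero: "square_integrable (\<lambda>x. 0)"
  by (simp add: square_integrable_def)

lemma integrable_mult_of_square_integrable:
  assumes "square_integrable f" "square_integrable g"
  shows "integrable lborel (\<lambda>x. f x * g x)"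
proof (rule Bochner_Integration.integrable_bound)
  show "integrable lborel (\<lambda>x. (f x)\<^sup>2 + (g x)\<^sup>2)"
    using assms by (auto simp: square_integrable_def)
  show "(\<lambda>x. f x * g x) \<in> borel_measurable lborel"
    using assms by (auto simp: square_integrable_def)
  have "\<bar>f x * g x\<bar> \<le> \<bar>(f x)\<^sup>2 + (g x)\<^sup>2\<bar>" for x
  proof -
    have "2 * \<bar>f x\<bar> * \<bar>g x\<bar> \<le> (f x)\<^sup>2 + (g x)\<^sup>2"
      using sum_squares_bound[of "\<bar>f x\<bar>" "\<bar>g x\<bar>"] by simp
    moreover have "0 \<le> \<bar>f x\<bar> * \<bar>g x\<bar>" by simp
    ultimately have "\<bar>f x\<bar> * \<bar>g x\<bar> \<le> (f x)\<^sup>2 + (g x)\<^sup>2"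
      unfolding mult.assoc by linarith
    then show ?thesis by (simp add: abs_mult)
  qed
  then show "AE x in lborel. norm (f x * g x) \<le> norm ((f x)\<^sup>2 + (g x)\<^sup>2)" by simp
qed

lemma square_integrable_scale:
  "square_integrable f \<Longrightarrow> square_integrable (\<lambda>x. c * f x)"
  by (auto simp: square_integrable_def power_mult_distrib)

lemma square_integrable_add:
  assumes "square_integrable f" "square_integrable g"
  shows "square_integrable (\<lambda>x. f x + g x)"
proof -
  have "integrable lborel (\<lambda>x. (f x)\<^sup>2 + (g x)\<^sup>2 + 2 * (f x * g x))"
    using assms integrable_mult_of_square_integrable[OF assms]
    by (auto simp: square_integrable_def)
  then show ?thesis
    using assms by (auto simp: square_integrable_def power2_sum mult.assoc)
qed

lemma square_integrable_uminus:
  "square_integrable f \<Longrightarrow> square_integrable (\<lambda>x. - f x)"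
  using square_integrable_scale[of f "-1"] by simp

lemma square_integrable_diff:
  "square_integrable f \<Longrightarrow> square_integrable g \<Longrightarrow> square_integrable (\<lambda>x. f x - g x)"
  using square_integrable_add[OF _ square_integrable_uminus, of f g] by simp

quotient_type (overloaded) 'd L2 = "real ^ ('d::finite) \<Rightarrow> real" / partial: L2_rel
proof (rule part_equivpI)
  show "\<exists>f :: real ^ 'd \<Rightarrow> real. L2_rel f f"
    using square_integrable_zero by (auto simp: L2_rel_def)
  show "symp (L2_rel :: (real ^ 'd \<Rightarrow> real) \<Rightarrow> _)"
    by (auto simp: symp_def L2_rel_def elim: eventually_mono)
  show "transp (L2_rel :: (real ^ 'd \<Rightarrow> real) \<Rightarrow> _)"
  proof (rule transpI)
    fix f g h :: "real ^ 'd \<Rightarrow> real"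
    assume "L2_rel f g" "L2_rel g h"
    then show "L2_rel f h"
      unfolding L2_rel_def by (auto elim: eventually_elim2)
  qed
qed

instantiation L2 :: (finite) real_inner
begin

lift_definition zero_L2 :: "'a L2" is "\<lambda>x. 0"
  by (simp add: L2_rel_def square_integrable_zero)

lift_definition plus_L2 :: "'a L2 \<Rightarrow> 'a L2 \<Rightarrow> 'a L2" is "\<lambda>f g x. f x + g x"
  by (auto simp: L2_rel_def square_integrable_add elim: eventually_elim2)

lift_definition minus_L2 :: "'a L2 \<Rightarrow> 'a L2 \<Rightarrow> 'a L2" is "\<lambda>f g x. f x - g x"
  by (auto simp: L2_rel_def square_integrable_diff elim: eventually_elim2)

lift_definition uminus_L2 :: "'a L2 \<Rightarrow> 'a L2" is "\<lambda>f x. - f x"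
  by (auto simp: L2_rel_def square_integrable_uminus elim: eventually_mono)

lift_definition scaleR_L2 :: "real \<Rightarrow> 'a L2 \<Rightarrow> 'a L2" is "\<lambda>c f x. c * f x"
  by (auto simp: L2_rel_def square_integrable_scale elim: eventually_mono)

lift_definition inner_L2 :: "'a L2 \<Rightarrow> 'a L2 \<Rightarrow> real" is "\<lambda>f g. LINT x|lborel. f x * g x"
proof (rule integral_cong_AE)
  fix f f' g g' :: "real ^ 'a \<Rightarrow> real"
  assume rel: "L2_rel f f'" "L2_rel g g'"
  show "AE x in lborel. f x * g x = f' x * g' x"
    using rel unfolding L2_rel_def by (auto elim: eventually_elim2)
  show "(\<lambda>x. f x * g x) \<in> borel_measurable lborel" "(\<lambda>x. f' x * g' x) \<in> borel_measurable lborel"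
    using rel unfolding L2_rel_def square_integrable_def by auto
qed

definition norm_L2 :: "'a L2 \<Rightarrow> real" where
  "norm_L2 f = sqrt (inner f f)"

definition dist_L2 :: "'a L2 \<Rightarrow> 'a L2 \<Rightarrow> real" where
  "dist_L2 f g = norm (f - g)"

definition sgn_L2 :: "'a L2 \<Rightarrow> 'a L2" where
  "sgn_L2 f = scaleR (inverse (norm f)) f"

definition uniformity_L2 :: "('a L2 \<times> 'a L2) filter" where
  "uniformity_L2 = (INF e\<in>{0 <..}. principal {(x, y). dist x y < e})"

definition open_L2 :: "'a L2 set \<Rightarrow> bool" where
  "open_L2 S \<longleftrightarrow> (\<forall>x\<in>S. \<forall>\<^sub>F (x', y) in uniformity. x' = x \<longrightarrow> y \<in> S)"

instance
proof
  fix a b c :: real and x y z :: "'a L2"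
  show "x + y + z = x + (y + z)"
    by transfer (auto simp: L2_rel_def add.assoc intro!: square_integrable_add)
  show "x + y = y + x"
    by transfer (auto simp: L2_rel_def add.commute intro!: square_integrable_add)
  show "0 + x = x"
    by transfer (auto simp: L2_rel_def)
  show "- x + x = 0"
    by transfer (auto simp: L2_rel_def square_integrable_zero)
  show "x - y = x + - y"
    by transfer (auto simp: L2_rel_def square_integrable_diff)
  show "a *\<^sub>R (x + y) = a *\<^sub>R x + a *\<^sub>R y"
    by transfer (auto simp: L2_rel_def distrib_left
        intro!: square_integrable_scale square_integrable_add)
  show "(a + b) *\<^sub>R x = a *\<^sub>R x + b *\<^sub>R x"
    by transfer (auto simp: L2_rel_def distrib_right
        intro!: square_integrable_scale square_integrable_add)
  show "a *\<^sub>R b *\<^sub>R x = (a * b) *\<^sub>R x"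
    by transfer (auto simp: L2_rel_def mult.assoc intro!: square_integrable_scale)
  show "1 *\<^sub>R x = x"
    by transfer (auto simp: L2_rel_def)
  show "dist x y = norm (x - y)"
    by (simp add: dist_L2_def)
  show "sgn x = scaleR (inverse (norm x)) x"
    by (simp add: sgn_L2_def)
  show "uniformity = (INF e\<in>{0 <..}. principal {(x, y :: 'a L2). dist x y < e})"
    by (simp add: uniformity_L2_def)
  fix S :: "'a L2 set"
  show "open S = (\<forall>x\<in>S. \<forall>\<^sub>F (x', y) in uniformity. x' = x \<longrightarrow> y \<in> S)"
    by (simp add: open_L2_def)
  show "inner x y = inner y x"
    by transfer (simp add: mult.commute)
  show "inner (x + y) z = inner x z + inner y z"
    by transfer (auto simp: L2_rel_def distrib_right intro!: Bochner_Integration.integral_add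
        integrable_mult_of_square_integrable)
  show "inner (a *\<^sub>R x) y = a * inner x y"
    by transfer (simp add: mult.assoc)
  show "0 \<le> inner x x"
    by transfer simp
  show "inner x x = 0 \<longleftrightarrow> x = 0"
  proof transfer
    fix f :: "real ^ 'a \<Rightarrow> real"
    assume "L2_rel f f"
    then have f: "square_integrable f" by (simp add: L2_rel_def)
    have "(LINT x|lborel. f x * f x) = 0 \<longleftrightarrow> (AE x in lborel. f x * f x = 0)"
      using integrable_mult_of_square_integrable[OF f f]
      by (intro integral_nonneg_eq_0_iff_AE) auto
    then show "(LINT x|lborel. f x * f x) = 0 \<longleftrightarrow> L2_rel f (\<lambda>x. 0)"
      using f by (simp add: L2_rel_def square_integrable_zero)
  qed
  show "norm x = sqrt (inner x x)"
    by (simp add: norm_L2_def)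
qed

end

text \<open>
  \<open>L\<^sup>2(\<Omega>)\<close> is identified, isometrically by extension by zero, with the subspace of
  \<open>L\<^sup>2(\<real>\<^sup>d)\<close> of the classes having a representative that vanishes outside \<open>\<Omega>\<close>. The \<open>L\<^sup>2(\<Omega>)\<close>
  inner product is then \<^const>\<open>inner\<close>.
\<close>

definition L2_on :: "(real ^ 'd) set \<Rightarrow> ('d::finite) L2 set" where
  "L2_on \<Omega> = {abs_L2 f | f. square_integrable f \<and> (\<forall>x. x \<notin> \<Omega> \<longrightarrow> f x = 0)}"


section \<open>Lipschitz domains and Sobolev spaces\<close>

text \<open>
  Near each boundary point the domain is the strict epigraph, in some unit direction \<open>e\<close>, of a
  Lipschitz function of the component orthogonal to \<open>e\<close>.
\<close>

definition bounded_lipschitz_domain :: "(real ^ 'd) set \<Rightarrow> bool" where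
  "bounded_lipschitz_domain \<Omega> \<longleftrightarrow>
     open \<Omega> \<and> connected \<Omega> \<and> \<Omega> \<noteq> {} \<and> bounded \<Omega> \<and>
     (\<forall>x\<in>frontier \<Omega>. \<exists>r>0. \<exists>e. norm e = 1 \<and>
        (\<exists>L g. L-lipschitz_on {z. z \<bullet> e = 0} g \<and>
           \<Omega> \<inter> ball x r = {z \<in> ball x r. z \<bullet> e > g (z - (z \<bullet> e) *\<^sub>R e)}))"

definition partial_deriv :: "'d \<Rightarrow> (real ^ 'd \<Rightarrow> real) \<Rightarrow> real ^ 'd \<Rightarrow> real" where
  "partial_deriv i f = (\<lambda>x. frechet_derivative f (at x) (axis i 1))"

fun times_differentiable :: "nat \<Rightarrow> (real ^ 'd \<Rightarrow> real) \<Rightarrow> bool" where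
  "times_differentiable 0 f \<longleftrightarrow> continuous_on UNIV f"
| "times_differentiable (Suc n) f \<longleftrightarrow>
     (\<forall>x. f differentiable (at x)) \<and> (\<forall>i. times_differentiable n (partial_deriv i f))"

definition test_functions :: "(real ^ 'd) set \<Rightarrow> (real ^ 'd \<Rightarrow> real) set" where
  "test_functions \<Omega> = {\<phi>. (\<forall>n. times_differentiable n \<phi>) \<and>
     compact (closure {x. \<phi> x \<noteq> 0}) \<and> closure {x. \<phi> x \<noteq> 0} \<subseteq> \<Omega>}"

definition has_weak_partial ::
  "(real ^ 'd) set \<Rightarrow> 'd \<Rightarrow> ('d::finite) L2 \<Rightarrow> 'd L2 \<Rightarrow> bool" where
  "has_weak_partial \<Omega> i f g \<longleftrightarrow> g \<in> L2_on \<Omega> \<and>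
     (\<forall>\<phi>\<in>test_functions \<Omega>. inner f (abs_L2 (partial_deriv i \<phi>)) = - inner g (abs_L2 \<phi>))"

text \<open>The weak derivative is unique because test functions are dense in \<open>L\<^sup>2(\<Omega>)\<close>, \<open>\<Omega>\<close> open.\<close>

definition weak_partial :: "(real ^ 'd) set \<Rightarrow> 'd \<Rightarrow> ('d::finite) L2 \<Rightarrow> 'd L2" where
  "weak_partial \<Omega> i f = (THE g. has_weak_partial \<Omega> i f g)"

definition H1 :: "(real ^ 'd) set \<Rightarrow> ('d::finite) L2 set" where
  "H1 \<Omega> = {f \<in> L2_on \<Omega>. \<forall>i. \<exists>g. has_weak_partial \<Omega> i f g}"

definition H1_norm :: "(real ^ 'd) set \<Rightarrow> ('d::finite) L2 \<Rightarrow> real" where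
  "H1_norm \<Omega> f = sqrt ((norm f)\<^sup>2 + (\<Sum>i\<in>UNIV. (norm (weak_partial \<Omega> i f))\<^sup>2))"

definition H1_0 :: "(real ^ 'd) set \<Rightarrow> ('d::finite) L2 set" where
  "H1_0 \<Omega> = {f \<in> H1 \<Omega>. \<forall>\<epsilon>>0. \<exists>\<phi>\<in>test_functions \<Omega>. H1_norm \<Omega> (f - abs_L2 \<phi>) < \<epsilon>}"


section \<open>Forms, inner products and norms on subspaces\<close>

definition linear_form_on :: "'a::real_vector set \<Rightarrow> ('a \<Rightarrow> real) \<Rightarrow> bool" where
  "linear_form_on V f \<longleftrightarrow>
     (\<forall>v\<in>V. \<forall>w\<in>V. f (v + w) = f v + f w) \<and> (\<forall>c. \<forall>v\<in>V. f (c *\<^sub>R v) = c * f v)"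

definition bilinear_form_on ::
  "'a::real_vector set \<Rightarrow> 'b::real_vector set \<Rightarrow> ('a \<Rightarrow> 'b \<Rightarrow> real) \<Rightarrow> bool" where
  "bilinear_form_on W V b \<longleftrightarrow>
     (\<forall>w\<in>W. linear_form_on V (b w)) \<and> (\<forall>v\<in>V. linear_form_on W (\<lambda>w. b w v))"

definition inner_product_on :: "'a::real_vector set \<Rightarrow> ('a \<Rightarrow> 'a \<Rightarrow> real) \<Rightarrow> bool" where
  "inner_product_on V ip \<longleftrightarrow> bilinear_form_on V V ip \<and>
     (\<forall>v\<in>V. \<forall>w\<in>V. ip v w = ip w v) \<and> (\<forall>v\<in>V - {0}. ip v v > 0)"

definition ip_norm :: "('a \<Rightarrow> 'a \<Rightarrow> real) \<Rightarrow> 'a \<Rightarrow> real" where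
  "ip_norm ip v = sqrt (ip v v)"

definition hilbert_space_on :: "'a::real_vector set \<Rightarrow> ('a \<Rightarrow> 'a \<Rightarrow> real) \<Rightarrow> bool" where
  "hilbert_space_on V ip \<longleftrightarrow> subspace V \<and> inner_product_on V ip \<and>
     (\<forall>x. (\<forall>n::nat. x n \<in> V) \<and>
          (\<forall>\<epsilon>>0. \<exists>M. \<forall>m\<ge>M. \<forall>n\<ge>M. ip_norm ip (x m - x n) < \<epsilon>) \<longrightarrow>
          (\<exists>l\<in>V. (\<lambda>n. ip_norm ip (x n - l)) \<longlonglongrightarrow> 0))"

definition finite_dim_subspace :: "'a::real_vector set \<Rightarrow> bool" where
  "finite_dim_subspace V \<longleftrightarrow> (\<exists>B. finite B \<and> V = span B)"

definition continuous_linear_form_on ::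
  "'a::real_vector set \<Rightarrow> ('a \<Rightarrow> 'a \<Rightarrow> real) \<Rightarrow> ('a \<Rightarrow> real) \<Rightarrow> bool" where
  "continuous_linear_form_on V ip f \<longleftrightarrow> linear_form_on V f \<and>
     (\<exists>c. \<forall>v\<in>V. \<bar>f v\<bar> \<le> c * ip_norm ip v)"

definition continuous_bilinear_form_on ::
  "'a::real_vector set \<Rightarrow> ('a \<Rightarrow> 'a \<Rightarrow> real) \<Rightarrow> 'b::real_vector set \<Rightarrow> ('b \<Rightarrow> 'b \<Rightarrow> real) \<Rightarrow>
   ('a \<Rightarrow> 'b \<Rightarrow> real) \<Rightarrow> bool" where
  "continuous_bilinear_form_on W ipW V ipV b \<longleftrightarrow> bilinear_form_on W V b \<and>
     (\<exists>c. \<forall>w\<in>W. \<forall>v\<in>V. \<bar>b w v\<bar> \<le> c * ip_norm ipW w * ip_norm ipV v)"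

text \<open>
  Suprema and infima are taken in the extended reals. On a trivial space the suprema are \<open>-\<infinity>\<close>,
  which \<^const>\<open>real_of_ereal\<close> turns into the intended value \<open>0\<close>, and the coercivity
  constant is \<open>\<infinity>\<close>.
\<close>

definition dual_norm :: "'a::zero set \<Rightarrow> ('a \<Rightarrow> 'a \<Rightarrow> real) \<Rightarrow> ('a \<Rightarrow> real) \<Rightarrow> ereal" where
  "dual_norm V ip r = (SUP v\<in>V - {0}. ereal (r v / ip_norm ip v))"

definition bilinear_form_norm ::
  "'a::zero set \<Rightarrow> ('a \<Rightarrow> 'a \<Rightarrow> real) \<Rightarrow> 'b::zero set \<Rightarrow> ('b \<Rightarrow> 'b \<Rightarrow> real) \<Rightarrow>
   ('a \<Rightarrow> 'b \<Rightarrow> real) \<Rightarrow> ereal" where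
  "bilinear_form_norm W ipW V ipV b =
     (SUP w\<in>W - {0}. SUP v\<in>V - {0}. ereal (b w v / (ip_norm ipW w * ip_norm ipV v)))"

definition operator_norm ::
  "'a::zero set \<Rightarrow> ('a \<Rightarrow> 'a \<Rightarrow> real) \<Rightarrow> ('b \<Rightarrow> 'b \<Rightarrow> real) \<Rightarrow> ('a \<Rightarrow> 'b) \<Rightarrow> ereal" where
  "operator_norm V ipV ipD C = (SUP v\<in>V - {0}. ereal (ip_norm ipD (C v) / ip_norm ipV v))"

definition coercivity_constant ::
  "'a::zero set \<Rightarrow> ('a \<Rightarrow> 'a \<Rightarrow> real) \<Rightarrow> ('a \<Rightarrow> 'a \<Rightarrow> real) \<Rightarrow> ereal" where
  "coercivity_constant V ip a = (INF v\<in>V - {0}. ereal (a v v / (ip_norm ip v)\<^sup>2))"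


section \<open>The discrete optimal control problem\<close>

text \<open>
  Elements of \<open>V\<^sup>K\<close> are functions on \<^typ>\<open>nat\<close> of which only the values at \<open>1, \<dots>, K\<close> matter; for
  states also the initial value at \<open>0\<close>, and for adjoints also the terminal value at \<open>K + 1\<close>.
  The form \<open>m\<close> is \<^const>\<open>inner\<close>.
\<close>

definition observation :: "('l \<Rightarrow> 'a \<Rightarrow> real) \<Rightarrow> 'a \<Rightarrow> real ^ 'l" where
  "observation h \<phi> = (\<chi> i. h i \<phi>)"

definition cost ::
  "('a::real_inner \<Rightarrow> 'a \<Rightarrow> real) \<Rightarrow> (real ^ 'l \<Rightarrow> real ^ 'l \<Rightarrow> real) \<Rightarrow> ('a \<Rightarrow> real ^ 'l) \<Rightarrow>
   real \<Rightarrow> nat \<Rightarrow> (nat \<Rightarrow> 'a) \<Rightarrow> (nat \<Rightarrow> real ^ 'l) \<Rightarrow> (nat \<Rightarrow> 'a) \<Rightarrow> (nat \<Rightarrow> 'a) \<Rightarrow> real" where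
  "cost ipU ipD C \<tau> K ud zd y u =
     \<tau> / 2 * (\<Sum>k=1..K. (ip_norm ipU (u k - ud k))\<^sup>2) +
     \<tau> / 2 * (\<Sum>k=1..K. (ip_norm ipD (C (y k) - zd k))\<^sup>2)"

definition feasible ::
  "'a::real_inner set \<Rightarrow> 'a set \<Rightarrow> ('a \<Rightarrow> 'a \<Rightarrow> real) \<Rightarrow> ('a \<Rightarrow> 'a \<Rightarrow> real) \<Rightarrow> ('a \<Rightarrow> real) \<Rightarrow>
   real \<Rightarrow> nat \<Rightarrow> 'a \<Rightarrow> (nat \<Rightarrow> 'a) \<Rightarrow> (nat \<Rightarrow> 'a) \<Rightarrow> bool" where
  "feasible V W a b f \<tau> K y0 y u \<longleftrightarrow>
     (\<forall>k\<in>{0..K}. y k \<in> V) \<and> (\<forall>k\<in>{1..K}. u k \<in> W) \<and>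
     (\<forall>v\<in>V. inner (y 0) v = inner y0 v) \<and>
     (\<forall>k\<in>{1..K}. \<forall>v\<in>V.
        inner (y k) v + \<tau> * a (y k) v = inner (y (k - 1)) v + \<tau> * b (u k) v + \<tau> * f v)"

definition optimal ::
  "'a::real_inner set \<Rightarrow> 'a set \<Rightarrow> ('a \<Rightarrow> 'a \<Rightarrow> real) \<Rightarrow> ('a \<Rightarrow> 'a \<Rightarrow> real) \<Rightarrow> ('a \<Rightarrow> real) \<Rightarrow>
   ('a \<Rightarrow> 'a \<Rightarrow> real) \<Rightarrow> (real ^ 'l \<Rightarrow> real ^ 'l \<Rightarrow> real) \<Rightarrow> ('a \<Rightarrow> real ^ 'l) \<Rightarrow>
   real \<Rightarrow> nat \<Rightarrow> 'a \<Rightarrow> (nat \<Rightarrow> 'a) \<Rightarrow> (nat \<Rightarrow> real ^ 'l) \<Rightarrow> (nat \<Rightarrow> 'a) \<Rightarrow> (nat \<Rightarrow> 'a) \<Rightarrow> bool" where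
  "optimal V W a b f ipU ipD C \<tau> K y0 ud zd y u \<longleftrightarrow>
     is_arg_min (\<lambda>(y, u). cost ipU ipD C \<tau> K ud zd y u)
       (\<lambda>(y, u). feasible V W a b f \<tau> K y0 y u) (y, u)"

text \<open>
  For a minimizer \<open>(y, u)\<close>, the adjoint \<open>p\<close> in the first-order optimality system is the unique solution
  of the equation below; the gradient equation \<open>(u\<^sup>k - u\<^sub>d\<^sup>k, \<psi>)\<^sub>U = b(\<psi>, p\<^sup>k)\<close> is then a consequence of
  minimality.
\<close>

definition solves_adjoint ::
  "'a::real_inner set \<Rightarrow> ('a \<Rightarrow> 'a \<Rightarrow> real) \<Rightarrow> (real ^ 'l \<Rightarrow> real ^ 'l \<Rightarrow> real) \<Rightarrow>
   ('a \<Rightarrow> real ^ 'l) \<Rightarrow> real \<Rightarrow> nat \<Rightarrow> (nat \<Rightarrow> real ^ 'l) \<Rightarrow> (nat \<Rightarrow> 'a) \<Rightarrow> (nat \<Rightarrow> 'a) \<Rightarrow> bool" where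
  "solves_adjoint V a ipD C \<tau> K zd y p \<longleftrightarrow>
     (\<forall>k\<in>{1..K}. p k \<in> V) \<and> p (K + 1) = 0 \<and>
     (\<forall>k\<in>{1..K}. \<forall>v\<in>V.
        inner v (p k - p (k + 1)) + \<tau> * a v (p k) = \<tau> * ipD (zd k - C (y k)) (C v))"

definition state_residual ::
  "('a::real_inner \<Rightarrow> 'a \<Rightarrow> real) \<Rightarrow> ('a \<Rightarrow> 'a \<Rightarrow> real) \<Rightarrow> ('a \<Rightarrow> real) \<Rightarrow> real \<Rightarrow>
   (nat \<Rightarrow> 'a) \<Rightarrow> (nat \<Rightarrow> 'a) \<Rightarrow> nat \<Rightarrow> 'a \<Rightarrow> real" where
  "state_residual a b f \<tau> y u k \<phi> =
     f \<phi> + b (u k) \<phi> - a (y k) \<phi> - 1 / \<tau> * inner (y k - y (k - 1)) \<phi>"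

definition adjoint_residual ::
  "('a::real_inner \<Rightarrow> 'a \<Rightarrow> real) \<Rightarrow> (real ^ 'l \<Rightarrow> real ^ 'l \<Rightarrow> real) \<Rightarrow> ('a \<Rightarrow> real ^ 'l) \<Rightarrow> real \<Rightarrow>
   (nat \<Rightarrow> real ^ 'l) \<Rightarrow> (nat \<Rightarrow> 'a) \<Rightarrow> (nat \<Rightarrow> 'a) \<Rightarrow> nat \<Rightarrow> 'a \<Rightarrow> real" where
  "adjoint_residual a ipD C \<tau> zd y p k \<phi> =
     ipD (zd k - C (y k)) (C \<phi>) - a \<phi> (p k) - 1 / \<tau> * inner \<phi> (p k - p (k + 1))"

definition control_residual ::
  "('a::real_inner \<Rightarrow> 'a \<Rightarrow> real) \<Rightarrow> ('a \<Rightarrow> 'a \<Rightarrow> real) \<Rightarrow> (nat \<Rightarrow> 'a) \<Rightarrow>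
   (nat \<Rightarrow> 'a) \<Rightarrow> (nat \<Rightarrow> 'a) \<Rightarrow> nat \<Rightarrow> 'a \<Rightarrow> real" where
  "control_residual b ipU ud u p k \<psi> = b \<psi> (p k) - ipU (u k - ud k) \<psi>"

definition total_residual ::
  "'a::zero set \<Rightarrow> ('a \<Rightarrow> 'a \<Rightarrow> real) \<Rightarrow> real \<Rightarrow> nat \<Rightarrow> (nat \<Rightarrow> 'a \<Rightarrow> real) \<Rightarrow> real" where
  "total_residual V ip \<tau> K r =
     sqrt (\<tau> * (\<Sum>k=1..K. (real_of_ereal (dual_norm V ip (r k)))\<^sup>2))"

end

theory Submission
  imports Defs
begin

text \<open>
  The adjoint of the full-order problem is not needed. Let \<open>e = u - u\<^sub>N\<close>, let \<open>z\<close> be the full-order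
  linear state driven by \<open>e\<close> with zero initial value, and let \<open>\<eta> = y - y\<^sub>N - z\<close>, which solves the state
  equation with right-hand side \<open>r\<^sub>y\<close>. Testing the minimality of \<open>(y, u)\<close> in the direction \<open>(z, e)\<close> and
  the equation of \<open>p\<^sub>N\<close> (up to \<open>r\<^sub>p\<close>) with \<open>z\<close> gives, after summation by parts,
  \<open>\<Sum> \<parallel>e\<parallel>\<^sup>2 = \<Sum> (r\<^sub>u(e) + r\<^sub>p(z) - (C(z + \<eta>), C z))\<close>, whose last term is at most \<open>\<parallel>C \<eta>\<parallel>\<^sup>2 / 4\<close>.
  Energy estimates bound \<open>z\<close> by \<open>\<gamma>\<^sub>b e / \<alpha>\<close> and \<open>\<eta>\<close> by \<open>R\<^sub>y / \<alpha>\<close>, which leaves a quadratic inequality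
  for the norm of \<open>e\<close>.
\<close>

section \<open>Linear and bilinear forms on a subspace\<close>

lemma linear_form_onD:
  assumes "linear_form_on V F" "subspace V"
  shows "v \<in> V \<Longrightarrow> w \<in> V \<Longrightarrow> F (v + w) = F v + F w"
    and "v \<in> V \<Longrightarrow> F (c *\<^sub>R v) = c * F v"
    and "v \<in> V \<Longrightarrow> w \<in> V \<Longrightarrow> F (v - w) = F v - F w"
    and "F 0 = 0"
proof -
  show add: "F (v + w) = F v + F w" if "v \<in> V" "w \<in> V" for v w
    using assms that by (auto simp: linear_form_on_def)
  show scale: "F (c *\<^sub>R v) = c * F v" if "v \<in> V" for v c
    using assms that by (auto simp: linear_form_on_def)
  show "F (v - w) = F v - F w" if "v \<in> V" "w \<in> V"
    using add[of v "(-1) *\<^sub>R w"] scale[of w "-1"] that subspace_scale[OF assms(2), of w "-1"] by simp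
  show "F 0 = 0"
    using scale[of 0 0] subspace_0[OF assms(2)] by simp
qed

lemma linear_form_on_mono: "linear_form_on V F \<Longrightarrow> W \<subseteq> V \<Longrightarrow> linear_form_on W F"
  unfolding linear_form_on_def by blast

lemma bilinear_form_on_mono:
  "bilinear_form_on V V' B \<Longrightarrow> W \<subseteq> V \<Longrightarrow> W' \<subseteq> V' \<Longrightarrow> bilinear_form_on W W' B"
  unfolding bilinear_form_on_def linear_form_on_def by (simp add: subset_iff)

lemma bilinear_form_onD:
  assumes "bilinear_form_on V W B"
  shows "v \<in> V \<Longrightarrow> linear_form_on W (B v)" and "w \<in> W \<Longrightarrow> linear_form_on V (\<lambda>v. B v w)"
  using assms by (auto simp: bilinear_form_on_def)

lemma bilinear_form_on_arith:
  assumes B: "bilinear_form_on V W B" and V: "subspace V" and W: "subspace W"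
  shows "v \<in> V \<Longrightarrow> v' \<in> V \<Longrightarrow> w \<in> W \<Longrightarrow> B (v + v') w = B v w + B v' w"
    and "v \<in> V \<Longrightarrow> v' \<in> V \<Longrightarrow> w \<in> W \<Longrightarrow> B (v - v') w = B v w - B v' w"
    and "v \<in> V \<Longrightarrow> w \<in> W \<Longrightarrow> B (c *\<^sub>R v) w = c * B v w"
    and "v \<in> V \<Longrightarrow> w \<in> W \<Longrightarrow> w' \<in> W \<Longrightarrow> B v (w + w') = B v w + B v w'"
    and "v \<in> V \<Longrightarrow> w \<in> W \<Longrightarrow> w' \<in> W \<Longrightarrow> B v (w - w') = B v w - B v w'"
    and "v \<in> V \<Longrightarrow> w \<in> W \<Longrightarrow> B v (c *\<^sub>R w) = c * B v w"
    and "w \<in> W \<Longrightarrow> B 0 w = 0"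
    and "v \<in> V \<Longrightarrow> B v 0 = 0"
  by (auto intro: linear_form_onD[OF bilinear_form_onD(1)[OF B] W]
    linear_form_onD[OF bilinear_form_onD(2)[OF B] V])

text \<open>
  Induction on a spanning set: the new direction is made \<open>B\<close>-orthogonal to the span of the old ones,
  so that the equation for its coefficient decouples.
\<close>

lemma lax_milgram_finite_dim:
  fixes B :: "'a::real_vector \<Rightarrow> 'a \<Rightarrow> real"
  assumes "finite S" "bilinear_form_on (span S) (span S) B"
    and "\<And>v. v \<in> span S \<Longrightarrow> v \<noteq> 0 \<Longrightarrow> B v v > 0" "linear_form_on (span S) F"
  shows "\<exists>w\<in>span S. \<forall>v\<in>span S. B w v = F v"
  using assms
proof (induction S arbitrary: F rule: finite_induct)
  case empty
  have "subspace {0::'a}" by simp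
  then show ?case
    using linear_form_onD(4)[of "{0}" F] bilinear_form_on_arith(8)[of "{0}" "{0}" B 0] empty.prems
    by auto
next
  case (insert e S)
  let ?V = "span S" and ?V' = "span (insert e S)"
  have sub: "?V \<subseteq> ?V'" by (rule span_mono) auto
  note lin' = bilinear_form_on_arith[OF insert.prems(1) subspace_span subspace_span]
  note F' = linear_form_onD[OF insert.prems(3) subspace_span]
  have e: "e \<in> ?V'" by (simp add: span_base)
  have IH: "\<exists>w\<in>?V. \<forall>v\<in>?V. B w v = G v" if "linear_form_on ?V G" for G
    using insert.IH[OF bilinear_form_on_mono[OF insert.prems(1) sub sub] _ that] insert.prems(2) sub
    by blast
  show ?case
  proof (cases "e \<in> ?V")
    case True
    then have "?V' = ?V" by (simp add: span_redundant)
    then show ?thesis using IH insert.prems(3) by simp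
  next
    case False
    obtain w1 where w1: "w1 \<in> ?V" "\<forall>v\<in>?V. B w1 v = F v"
      using IH[OF linear_form_on_mono[OF insert.prems(3) sub]] by blast
    obtain w2 where w2: "w2 \<in> ?V" "\<forall>v\<in>?V. B w2 v = B e v"
      using IH[OF linear_form_on_mono[OF bilinear_form_onD(1)[OF insert.prems(1) e] sub]] by blast
    define z where "z = e - w2"
    have z: "z \<in> ?V'" "z \<noteq> 0"
      using e w2 sub False by (auto simp: z_def intro: span_diff)
    have zV: "B z v = 0" if "v \<in> ?V" for v
      using lin'(2)[OF e, of w2 v] w2 that sub by (auto simp: z_def)
    have zz: "B z z > 0" using insert.prems(2) z by blast
    \<comment> \<open>\<open>B\<close> need not be symmetric: \<open>z\<close> is annihilated as the
      first argument only, so \<open>B w1 z\<close> may be nonzero and is subtracted here. Adding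
      \<open>c *\<^sub>R z\<close> to \<open>w1\<close> leaves the equations tested in the old span
      intact.\<close>
    define c where "c = (F z - B w1 z) / B z z"
    let ?w = "w1 + c *\<^sub>R z"
    have w1': "w1 \<in> ?V'" and cz: "c *\<^sub>R z \<in> ?V'" using w1 sub z by (auto intro: span_scale)
    have w: "?w \<in> ?V'" using w1' cz by (rule span_add)
    have "B ?w v = F v" if "v \<in> ?V'" for v
    proof -
      obtain k where k: "v - k *\<^sub>R e \<in> ?V" using \<open>v \<in> ?V'\<close> by (auto simp: span_breakdown_eq)
      \<comment> \<open>Splits \<open>v\<close> along \<open>z\<close> instead of \<open>e\<close>,
        with \<open>v0\<close> in the old span, so that it suffices to test with \<open>v0\<close>
        and with \<open>z\<close>.\<close>
      define v0 where "v0 = v - k *\<^sub>R e + k *\<^sub>R w2"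
      have v0: "v0 \<in> ?V" unfolding v0_def using k w2(1) by (intro span_add span_scale)
      have v: "v = v0 + k *\<^sub>R z" by (simp add: v0_def z_def algebra_simps)
      have v0': "v0 \<in> ?V'" and kz: "k *\<^sub>R z \<in> ?V'" using v0 sub z by (auto intro: span_scale)
      have "B ?w v0 = F v0"
        using lin'(1)[OF w1' cz v0'] lin'(3)[OF z(1) v0'] w1 zV v0 by simp
      moreover have "B ?w z = F z"
        using lin'(1)[OF w1' cz z(1)] lin'(3)[OF z(1) z(1)] zz by (simp add: c_def)
      ultimately show ?thesis
        unfolding v using lin'(4)[OF w v0' kz] lin'(6)[OF w z(1)] F'(1)[OF v0' kz] F'(2)[OF z(1)]
        by simp
    qed
    then show ?thesis using w by blast
  qed
qed

section \<open>Inner products and their norms on a subspace\<close>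

lemma inner_product_on_mono: "inner_product_on V ip \<Longrightarrow> W \<subseteq> V \<Longrightarrow> inner_product_on W ip"
  using bilinear_form_on_mono[of V V ip W W] by (auto simp: inner_product_on_def)

lemma inner_product_on_nonneg:
  assumes "inner_product_on V ip" "subspace V" "v \<in> V"
  shows "ip v v \<ge> 0"
  using assms bilinear_form_on_arith(7)[of V V ip 0]
  by (cases "v = 0") (auto simp: inner_product_on_def subspace_0 less_imp_le)

lemma ip_norm_square:
  assumes "inner_product_on V ip" "subspace V" "v \<in> V"
  shows "(ip_norm ip v)\<^sup>2 = ip v v" and "ip_norm ip v \<ge> 0"
  using inner_product_on_nonneg[OF assms] by (auto simp: ip_norm_def)

lemma ip_norm_pos:
  assumes "inner_product_on V ip" "v \<in> V" "v \<noteq> 0"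
  shows "ip_norm ip v > 0"
  using assms by (auto simp: inner_product_on_def ip_norm_def)

lemma inner_product_on_expand:
  assumes ip: "inner_product_on V ip" and V: "subspace V" and "v \<in> V" "w \<in> V"
  shows "ip (v + t *\<^sub>R w) (v + t *\<^sub>R w) = ip v v + 2 * t * ip v w + t\<^sup>2 * ip w w"
proof -
  have B: "bilinear_form_on V V ip" and sym: "ip w v = ip v w"
    using assms by (auto simp: inner_product_on_def)
  have "t *\<^sub>R w \<in> V" "v + t *\<^sub>R w \<in> V" using assms by (auto intro: subspace_scale subspace_add)
  then show ?thesis
    using assms sym
    by (simp add: bilinear_form_on_arith[OF B V V] power2_eq_square algebra_simps)
qed

lemma ip_Cauchy_Schwarz:
  assumes ip: "inner_product_on V ip" and V: "subspace V" and v: "v \<in> V" and w: "w \<in> V"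
  shows "\<bar>ip v w\<bar> \<le> ip_norm ip v * ip_norm ip w"
proof (cases "w = 0")
  case True
  then show ?thesis
    using ip bilinear_form_on_arith(8)[of V V ip v] bilinear_form_on_arith(8)[of V V ip 0] V v
    by (simp add: inner_product_on_def ip_norm_def subspace_0)
next
  case False
  then have ww: "ip w w > 0" using ip w by (auto simp: inner_product_on_def)
  \<comment> \<open>The minimiser of \<open>ip (v + t *\<^sub>R w) (v + t *\<^sub>R w)\<close> as a
    quadratic polynomial in \<open>t\<close>.\<close>
  define t where "t = - ip v w / ip w w"
  have "v + t *\<^sub>R w \<in> V" using V v w by (intro subspace_add subspace_scale)
  then have "0 \<le> ip v v + 2 * t * ip v w + t\<^sup>2 * ip w w"
    using inner_product_on_nonneg[OF ip V] inner_product_on_expand[OF ip V v w, of t] by metis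
  also have "\<dots> = ip v v - (ip v w)\<^sup>2 / ip w w"
    using ww by (simp add: t_def field_simps power2_eq_square)
  finally have "(ip v w)\<^sup>2 \<le> ip v v * ip w w" using ww by (simp add: field_simps)
  then have "sqrt ((ip v w)\<^sup>2) \<le> sqrt (ip v v * ip w w)" by (rule real_sqrt_le_mono)
  then show ?thesis by (simp add: ip_norm_def real_sqrt_mult)
qed

text \<open>In finite dimension the norm of the Riesz representative is a bound for the form. This
  makes dual norms of residuals finite.\<close>

lemma linear_form_on_bounded:
  assumes V: "finite_dim_subspace V" and ip: "inner_product_on V ip" and F: "linear_form_on V F"
  obtains c where "c \<ge> 0" "\<And>v. v \<in> V \<Longrightarrow> \<bar>F v\<bar> \<le> c * ip_norm ip v"
proof -
  obtain S where S: "finite S" "V = span S" using V by (auto simp: finite_dim_subspace_def)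
  then have sV: "subspace V" by simp
  \<comment> \<open>Riesz representation\<close>
  obtain w where w: "w \<in> V" "\<forall>v\<in>V. ip w v = F v"
    using lax_milgram_finite_dim[OF S(1), of ip F] ip F by (auto simp: S(2) inner_product_on_def)
  show ?thesis
    using that[of "ip_norm ip w"] ip_Cauchy_Schwarz[OF ip sV w(1)] w ip_norm_square(2)[OF ip sV w(1)]
    by auto
qed

section \<open>Pointwise bounds from suprema and infima in the extended reals\<close>

text \<open>\<open>real_of_ereal\<close> sends both infinities to 0, so the passage to the reals
  needs a finite supremum: the member \<open>x\<close> excludes the value minus infinity, the bound
  \<open>c\<close> excludes plus infinity. The size of \<open>c\<close> does not matter.\<close>

lemma le_real_of_ereal_SUP:
  fixes g :: "'a \<Rightarrow> real"
  assumes "x \<in> A" and "\<And>x. x \<in> A \<Longrightarrow> g x \<le> c"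
  shows "g x \<le> real_of_ereal (SUP x\<in>A. ereal (g x))"
proof -
  have "ereal (g x) \<le> (SUP x\<in>A. ereal (g x))" using assms(1) by (rule SUP_upper)
  moreover have "(SUP x\<in>A. ereal (g x)) \<le> ereal c" using assms(2) by (auto intro: SUP_least)
  ultimately show ?thesis by (cases "SUP x\<in>A. ereal (g x)") auto
qed

lemma ip_norm_uminus:
  assumes "inner_product_on V ip" "subspace V" "v \<in> V"
  shows "ip_norm ip (- v) = ip_norm ip v"
proof -
  have B: "bilinear_form_on V V ip" using assms by (simp add: inner_product_on_def)
  have "(-1) *\<^sub>R v \<in> V" using assms by (intro subspace_scale)
  then show ?thesis
    using bilinear_form_on_arith(3)[OF B assms(2,2,3), of "(-1) *\<^sub>R v" "-1"]
      bilinear_form_on_arith(6)[OF B assms(2,2,3,3), of "-1"]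
    by (simp add: ip_norm_def)
qed

lemma ip_norm_zero: "inner_product_on V ip \<Longrightarrow> subspace V \<Longrightarrow> ip_norm ip 0 = 0"
  using bilinear_form_on_arith(8)[of V V ip 0] by (simp add: inner_product_on_def ip_norm_def subspace_0)

lemma finite_dim_subspace_subspace: "finite_dim_subspace V \<Longrightarrow> subspace V"
  by (auto simp: finite_dim_subspace_def)

text \<open>The supremum runs over signed quotients; comparing \<open>v\<close> with
  \<open>- v\<close> gives the absolute value. The zero vector lies outside the supremum and is
  treated separately.\<close>

lemma abs_le_dual_norm:
  assumes V: "finite_dim_subspace V" and ip: "inner_product_on V ip" and F: "linear_form_on V F"
    and v: "v \<in> V"
  shows "\<bar>F v\<bar> \<le> real_of_ereal (dual_norm V ip F) * ip_norm ip v"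
proof -
  note sV = finite_dim_subspace_subspace[OF V]
  obtain c where c: "\<And>v. v \<in> V \<Longrightarrow> \<bar>F v\<bar> \<le> c * ip_norm ip v"
    using linear_form_on_bounded[OF V ip F] by blast
  have le: "F v \<le> real_of_ereal (dual_norm V ip F) * ip_norm ip v" if v: "v \<in> V" for v
  proof (cases "v = 0")
    case True
    then show ?thesis using linear_form_onD(4)[OF F sV] ip_norm_zero[OF ip sV] by simp
  next
    case False
    have "F v / ip_norm ip v \<le> real_of_ereal (dual_norm V ip F)"
      unfolding dual_norm_def
    proof (rule le_real_of_ereal_SUP)
      show "v \<in> V - {0}" using v False by simp
      show "F x / ip_norm ip x \<le> c" if "x \<in> V - {0}" for x
        using c[of x] ip_norm_pos[OF ip, of x] that by (auto simp: divide_le_eq)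
    qed
    then show ?thesis using ip_norm_pos[OF ip v False] by (simp add: divide_le_eq)
  qed
  have "F (- v) = - F v" "- v \<in> V"
    using linear_form_onD(2)[OF F sV v, of "-1"] subspace_scale[OF sV v, of "-1"] by auto
  then show ?thesis using le[OF v] le[of "- v"] ip_norm_uminus[OF ip sV v] by simp
qed

lemma abs_le_bilinear_form_norm:
  assumes W: "subspace W" and ipW: "inner_product_on W ipW"
    and V: "subspace V" and ipV: "inner_product_on V ipV"
    and b: "bilinear_form_on W V b" and fin: "bilinear_form_norm W ipW V ipV b < \<infinity>"
    and w: "w \<in> W" and v: "v \<in> V"
  shows "\<bar>b w v\<bar> \<le> real_of_ereal (bilinear_form_norm W ipW V ipV b) * ip_norm ipW w * ip_norm ipV v"
proof -
  note lin = bilinear_form_on_arith[OF b W V]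
  have le: "b w v \<le> real_of_ereal (bilinear_form_norm W ipW V ipV b) * ip_norm ipW w * ip_norm ipV v"
    if w: "w \<in> W" for w
  proof (cases "w = 0 \<or> v = 0")
    case True
    then show ?thesis
      using lin(7)[OF v] lin(8)[OF w] ip_norm_zero[OF ipW W] ip_norm_zero[OF ipV V] by auto
  next
    case False
    then have pos: "ip_norm ipW w > 0" "ip_norm ipV v > 0"
      using ip_norm_pos[OF ipW w] ip_norm_pos[OF ipV v] by auto
    have "ereal (b w v / (ip_norm ipW w * ip_norm ipV v)) \<le> bilinear_form_norm W ipW V ipV b"
      unfolding bilinear_form_norm_def using False w v by (auto intro!: SUP_upper2[of w] SUP_upper)
    then have "b w v / (ip_norm ipW w * ip_norm ipV v) \<le> real_of_ereal (bilinear_form_norm W ipW V ipV b)"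
      using fin by (cases "bilinear_form_norm W ipW V ipV b") auto
    then show ?thesis using pos by (simp add: divide_le_eq mult.assoc)
  qed
  have "b (- w) v = - b w v" "- w \<in> W"
    using lin(3)[OF w v, of "-1"] subspace_scale[OF W w, of "-1"] by auto
  then show ?thesis using le[OF w] le[of "- w"] ip_norm_uminus[OF ipW W w] by simp
qed

text \<open>On a trivial space the supremum is minus infinity, which becomes 0; otherwise the bound
  on \<open>\<bar>b w v\<bar>\<close> at one pair of nonzero vectors forces the sign.\<close>

lemma bilinear_form_norm_nonneg:
  assumes W: "subspace W" and ipW: "inner_product_on W ipW"
    and V: "subspace V" and ipV: "inner_product_on V ipV"
    and b: "bilinear_form_on W V b" and fin: "bilinear_form_norm W ipW V ipV b < \<infinity>"
  shows "real_of_ereal (bilinear_form_norm W ipW V ipV b) \<ge> 0"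
proof (cases "W - {0} = {} \<or> V - {0} = {}")
  case True
  then have "bilinear_form_norm W ipW V ipV b = - \<infinity>"
    unfolding bilinear_form_norm_def bot_ereal_def[symmetric] by auto
  then show ?thesis by simp
next
  case False
  then obtain w v where "w \<in> W" "w \<noteq> 0" "v \<in> V" "v \<noteq> 0" by blast
  then have "0 < ip_norm ipW w" "0 < ip_norm ipV v"
    "0 \<le> real_of_ereal (bilinear_form_norm W ipW V ipV b) * ip_norm ipW w * ip_norm ipV v"
    using ip_norm_pos[OF ipW] ip_norm_pos[OF ipV]
      order_trans[OF abs_ge_zero abs_le_bilinear_form_norm[OF assms]] by blast+
  then show ?thesis by (simp add: zero_le_mult_iff)
qed

lemma observation_linear:
  assumes "\<And>i. linear_form_on V (h i)" "subspace V"
  shows "v \<in> V \<Longrightarrow> w \<in> V \<Longrightarrow> observation h (v + w) = observation h v + observation h w"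
    and "v \<in> V \<Longrightarrow> w \<in> V \<Longrightarrow> observation h (v - w) = observation h v - observation h w"
    and "v \<in> V \<Longrightarrow> observation h (c *\<^sub>R v) = c *\<^sub>R observation h v"
  using linear_form_onD[OF assms(1) assms(2)] by (auto simp: observation_def vec_eq_iff)

text \<open>The point is that the operator norm is finite: each component \<open>h i\<close> is
  bounded because \<open>V\<close> has finite dimension, and an expansion in the standard basis
  turns these bounds into one for the \<open>ip\<close>-norm.\<close>

lemma ip_norm_observation_le:
  assumes V: "finite_dim_subspace V" and ipV: "inner_product_on V ipV"
    and h: "\<And>i. linear_form_on V (h i)" and ip: "inner_product_on UNIV ip" and v: "v \<in> V"
  shows "ip_norm ip (observation h v) \<le> real_of_ereal (operator_norm V ipV ip (observation h)) * ip_norm ipV v"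
proof -
  note sV = finite_dim_subspace_subspace[OF V]
  note B = bilinear_form_on_arith[of UNIV UNIV ip, simplified]
  have bil: "bilinear_form_on UNIV UNIV ip" and sym: "\<And>x y. ip x y = ip y x"
    using ip by (auto simp: inner_product_on_def)
  have "\<exists>c. \<forall>i. c i \<ge> 0 \<and> (\<forall>v\<in>V. \<bar>h i v\<bar> \<le> c i * ip_norm ipV v)"
    using linear_form_on_bounded[OF V ipV h] by (intro choice) metis
  then obtain c where c: "\<And>i. c i \<ge> 0" "\<And>i v. v \<in> V \<Longrightarrow> \<bar>h i v\<bar> \<le> c i * ip_norm ipV v" by blast
  \<comment> \<open>Dominates the expansion of \<open>ip (observation h v) (observation h v)\<close>
    through the Gram matrix of the standard basis.\<close>
  define M where "M = (\<Sum>i\<in>UNIV. \<Sum>j\<in>UNIV. c i * c j * \<bar>ip (axis i 1) (axis j 1)\<bar>)"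
  have M: "ip_norm ip (observation h v) \<le> sqrt M * ip_norm ipV v" if v: "v \<in> V" for v
  proof -
    have lin1: "linear (\<lambda>x. ip x z)" and lin2: "linear (ip z)" for z
      using B[OF bil] by (auto intro!: linearI)
    have exp: "observation h v = (\<Sum>i\<in>UNIV. h i v *\<^sub>R axis i 1)"
      by (simp add: observation_def vec_eq_iff axis_def if_distrib cong: if_cong)
    have "ip (observation h v) (observation h v) =
        (\<Sum>i\<in>UNIV. \<Sum>j\<in>UNIV. h i v * h j v * ip (axis i 1) (axis j 1))"
      unfolding exp
      by (simp add: linear_sum[OF lin1] linear_sum[OF lin2] linear_cmul[OF lin1] linear_cmul[OF lin2]
          sum_distrib_left mult_ac sym)
    also have "\<dots> \<le> (\<Sum>i\<in>UNIV. \<Sum>j\<in>UNIV. c i * c j * \<bar>ip (axis i 1) (axis j 1)\<bar> * (ip_norm ipV v)\<^sup>2)"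
    proof (intro sum_mono)
      fix i j
      let ?x = "ip (axis i 1) (axis j 1)"
      have "h i v * h j v * ?x \<le> \<bar>h i v\<bar> * \<bar>h j v\<bar> * \<bar>?x\<bar>"
        by (metis abs_ge_self abs_mult)
      also have "\<dots> \<le> (c i * ip_norm ipV v) * (c j * ip_norm ipV v) * \<bar>?x\<bar>"
        using c v ip_norm_square(2)[OF ipV sV v] by (intro mult_mono mult_nonneg_nonneg) auto
      finally show "h i v * h j v * ?x \<le> c i * c j * \<bar>?x\<bar> * (ip_norm ipV v)\<^sup>2"
        by (simp add: power2_eq_square mult_ac)
    qed
    also have "\<dots> = M * (ip_norm ipV v)\<^sup>2" by (simp add: M_def sum_distrib_right)
    finally have "ip_norm ip (observation h v) \<le> sqrt (M * (ip_norm ipV v)\<^sup>2)"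
      by (simp add: ip_norm_def)
    then show ?thesis using ip_norm_square(2)[OF ipV sV v] by (simp add: real_sqrt_mult)
  qed
  show ?thesis
  proof (cases "v = 0")
    case True
    have "observation h 0 = 0" using observation_linear(3)[where h = h and c = 0, OF h sV v] by simp
    then show ?thesis using True ip_norm_zero[OF ipV sV] ip_norm_zero[OF ip] by simp
  next
    case False
    have "ip_norm ip (observation h v) / ip_norm ipV v \<le> real_of_ereal (operator_norm V ipV ip (observation h))"
      unfolding operator_norm_def
    proof (rule le_real_of_ereal_SUP)
      show "v \<in> V - {0}" using v False by simp
      show "ip_norm ip (observation h x) / ip_norm ipV x \<le> sqrt M" if "x \<in> V - {0}" for x
        using M[of x] ip_norm_pos[OF ipV, of x] that by (auto simp: divide_le_eq)
    qed
    then show ?thesis using ip_norm_pos[OF ipV v False] by (simp add: divide_le_eq)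
  qed
qed

lemma coercivity_constant_le:
  assumes ip: "inner_product_on V ip" and V: "subspace V" and a: "bilinear_form_on V V a"
    and c: "ereal c \<le> coercivity_constant V ip a" and v: "v \<in> V"
  shows "c * (ip_norm ip v)\<^sup>2 \<le> a v v"
proof (cases "v = 0")
  case True
  then show ?thesis using bilinear_form_on_arith(8)[OF a V V v] ip_norm_zero[OF ip V] by simp
next
  case False
  have "ereal c \<le> ereal (a v v / (ip_norm ip v)\<^sup>2)"
    using c unfolding coercivity_constant_def
    by (rule order_trans) (use v False in \<open>auto intro: INF_lower\<close>)
  then show ?thesis using ip_norm_pos[OF ip v False] by (simp add: le_divide_eq)
qed

section \<open>The implicit Euler scheme: stability, summation by parts, solvability\<close>

text \<open>Each Euler step is tested with its own solution and the resulting inequalities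
  telescope. Here \<open>n\<close> stands for the energy norms and \<open>G\<close> for the dual
  norms of the right-hand sides; plain real sequences let one estimate serve for both
  \<open>z\<close> and \<open>\<eta>\<close> of the main proof.\<close>

lemma energy_estimate:
  fixes z :: "nat \<Rightarrow> 'a::real_inner" and A g G n :: "nat \<Rightarrow> real"
  assumes \<tau>: "\<tau> > 0" and \<alpha>: "\<alpha> > 0" and z0: "z 0 = 0"
    and eq: "\<And>k. k \<in> {1..K} \<Longrightarrow> inner (z k - z (k - 1)) (z k) + \<tau> * A k = \<tau> * g k"
    and A: "\<And>k. k \<in> {1..K} \<Longrightarrow> \<alpha> * (n k)\<^sup>2 \<le> A k"
    and g: "\<And>k. k \<in> {1..K} \<Longrightarrow> g k \<le> G k * n k"
  shows "\<alpha>\<^sup>2 * (\<Sum>k=1..K. (n k)\<^sup>2) \<le> (\<Sum>k=1..K. (G k)\<^sup>2)"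
proof -
  have step: "\<tau> * \<alpha>\<^sup>2 * (n k)\<^sup>2 + \<alpha> * (norm (z k))\<^sup>2 \<le> \<tau> * (G k)\<^sup>2 + \<alpha> * (norm (z (k - 1)))\<^sup>2"
    if k: "k \<in> {1..K}" for k
  proof -
    have "0 \<le> inner (z k - z (k - 1)) (z k - z (k - 1))" by simp
    then have "(norm (z k))\<^sup>2 - (norm (z (k - 1)))\<^sup>2 \<le> 2 * inner (z k - z (k - 1)) (z k)"
      by (simp add: power2_norm_eq_inner inner_diff inner_commute)
    then have "\<alpha> * ((norm (z k))\<^sup>2 - (norm (z (k - 1)))\<^sup>2) \<le> \<alpha> * (2 * (\<tau> * g k - \<tau> * A k))"
      using eq[OF k] \<alpha> by simp
    moreover have "(2 * \<alpha> * \<tau>) * (g k - A k) \<le> (2 * \<alpha> * \<tau>) * (G k * n k - \<alpha> * (n k)\<^sup>2)"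
      using A[OF k] g[OF k] \<alpha> \<tau> by (intro mult_left_mono) auto
    \<comment> \<open>Young's inequality, balanced so that half of the coercive term
      survives.\<close>
    moreover have "0 \<le> \<tau> * (G k - \<alpha> * n k)\<^sup>2" using \<tau> by simp
    ultimately show ?thesis by (simp add: power2_eq_square algebra_simps)
  qed
  have "\<tau> * \<alpha>\<^sup>2 * (\<Sum>k=1..j. (n k)\<^sup>2) + \<alpha> * (norm (z j))\<^sup>2 \<le> \<tau> * (\<Sum>k=1..j. (G k)\<^sup>2)" if "j \<le> K" for j
    using that
  proof (induction j)
    case 0
    then show ?case by (simp add: z0)
  next
    case (Suc j)
    then show ?case using step[of "Suc j"] by (simp add: distrib_left)
  qed
  from this[of K] have "\<tau> * (\<alpha>\<^sup>2 * (\<Sum>k=1..K. (n k)\<^sup>2)) \<le> \<tau> * (\<Sum>k=1..K. (G k)\<^sup>2)"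
    using mult_nonneg_nonneg[OF less_imp_le[OF \<alpha>] zero_le_power2[of "norm (z K)"]]
    unfolding mult.assoc by linarith
  then show ?thesis using \<tau> by simp
qed

text \<open>Moves the backward difference of a state onto the forward difference in the adjoint
  equation. Both boundary terms vanish when \<open>z 0 = 0\<close> and
  \<open>p (K + 1) = 0\<close>.\<close>

lemma discrete_summation_by_parts:
  fixes z p :: "nat \<Rightarrow> 'a::real_inner"
  shows "(\<Sum>k=1..K. inner (z k - z (k - 1)) (p k)) =
    (\<Sum>k=1..K. inner (z k) (p k - p (k + 1))) + inner (z K) (p (K + 1)) - inner (z 0) (p 1)"
  by (induction K) (auto simp: inner_diff)

text \<open>Every step is a finite-dimensional Lax-Milgram problem for
  \<open>inner w v + \<tau> * a w v\<close>, which is positive definite by its first summand as soon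
  as \<open>a\<close> is nonnegative on the diagonal.\<close>

lemma implicit_Euler_solvable:
  fixes V :: "'a::real_inner set" and g :: "nat \<Rightarrow> 'a \<Rightarrow> real"
  assumes V: "finite_dim_subspace V" and a: "bilinear_form_on V V a" and \<tau>: "\<tau> > 0"
    and coer: "\<And>v. v \<in> V \<Longrightarrow> a v v \<ge> 0" and g: "\<And>k. linear_form_on V (g k)"
  obtains z where "z 0 = 0" "\<And>k. z k \<in> V"
    "\<And>k v. v \<in> V \<Longrightarrow> inner (z (Suc k) - z k) v + \<tau> * a (z (Suc k)) v = \<tau> * g (Suc k) v"
proof -
  note sV = finite_dim_subspace_subspace[OF V]
  obtain S where S: "finite S" "V = span S" using V by (auto simp: finite_dim_subspace_def)
  have step: "\<exists>w\<in>V. \<forall>v\<in>V. inner (w - x) v + \<tau> * a w v = \<tau> * g k v" if x: "x \<in> V" for x k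
  proof -
    let ?B = "\<lambda>w v. inner w v + \<tau> * a w v" and ?F = "\<lambda>v. inner x v + \<tau> * g k v"
    have "bilinear_form_on V V ?B"
      unfolding bilinear_form_on_def linear_form_on_def
      by (auto simp: inner_add_left inner_add_right bilinear_form_on_arith[OF a sV sV] algebra_simps)
    moreover have "linear_form_on V ?F"
      using g[of k] by (auto simp: linear_form_on_def inner_add_right algebra_simps)
    moreover have "?B v v > 0" if "v \<in> V" "v \<noteq> 0" for v
      using coer[OF that(1)] that \<tau> by (simp add: add_pos_nonneg)
    ultimately obtain w where "w \<in> V" "\<forall>v\<in>V. ?B w v = ?F v"
      using lax_milgram_finite_dim[OF S(1), of ?B ?F] by (auto simp: S(2))
    then show ?thesis by (auto simp: inner_diff_left intro!: bexI[of _ w])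
  qed
  \<comment> \<open>The clause for \<open>k = 0\<close> carries the initial value through the
    dependent choice.\<close>
  have "\<exists>z. \<forall>k. (z k \<in> V \<and> (k = 0 \<longrightarrow> z k = 0)) \<and>
      (\<forall>v\<in>V. inner (z (Suc k) - z k) v + \<tau> * a (z (Suc k)) v = \<tau> * g (Suc k) v)"
    by (rule dependent_nat_choice[where P = "\<lambda>k x. x \<in> V \<and> (k = 0 \<longrightarrow> x = 0)"])
      (use subspace_0[OF sV] step in blast)+
  then obtain z where "\<forall>k. (z k \<in> V \<and> (k = 0 \<longrightarrow> z k = 0)) \<and>
      (\<forall>v\<in>V. inner (z (Suc k) - z k) v + \<tau> * a (z (Suc k)) v = \<tau> * g (Suc k) v)" ..
  then show ?thesis using that[of z] by simp
qed

section \<open>First-order optimality of a minimiser\<close>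

lemma linear_coeff_eq_0:
  fixes l q :: real
  assumes "\<And>t. 0 \<le> t * l + t\<^sup>2 * q"
  shows "l = 0"
proof (rule ccontr)
  assume l: "l \<noteq> 0"
  \<comment> \<open>With \<open>s * \<bar>q\<bar> < 1\<close>, the linear term outweighs the
    quadratic one at \<open>t = - s * l\<close> and makes the value negative.\<close>
  define s where "s = 1 / (1 + \<bar>q\<bar>)"
  have s: "s > 0" "s * \<bar>q\<bar> < 1" by (auto simp: s_def field_simps)
  have "0 \<le> (- s * l) * l + (- s * l)\<^sup>2 * q" by (rule assms)
  also have "\<dots> = s * l\<^sup>2 * (s * q - 1)" by (simp add: power2_eq_square algebra_simps)
  also have "\<dots> < 0"
    using s(1) l le_less_trans[OF mult_left_mono[OF abs_ge_self less_imp_le[OF s(1)]] s(2)]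
    by (intro mult_pos_neg) auto
  finally show False by simp
qed

text \<open>Since \<open>z\<close> solves the linearised state equation with control
  \<open>d\<close> and zero initial value, moving from \<open>(y, u)\<close> along
  \<open>(z, d)\<close> stays feasible for every real step. The cost is quadratic along this line
  and minimal at step 0, so its slope there vanishes.\<close>

lemma optimal_variational_equation:
  fixes V W :: "'a::real_inner set"
  assumes opt: "optimal V W a b f ipU ipD C \<tau> K y0 ud zd y u"
    and \<tau>: "\<tau> > 0" and V: "subspace V" and W: "subspace W"
    and a: "bilinear_form_on V V a" and b: "bilinear_form_on W V b"
    and ipU: "inner_product_on W ipU" and ipD: "inner_product_on UNIV ipD"
    and C: "\<And>v w t. v \<in> V \<Longrightarrow> w \<in> V \<Longrightarrow> C (v + t *\<^sub>R w) = C v + t *\<^sub>R C w"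
    and ud: "\<And>k. k \<in> {1..K} \<Longrightarrow> ud k \<in> W"
    and z: "z 0 = 0" "\<And>k. k \<le> K \<Longrightarrow> z k \<in> V" and d: "\<And>k. k \<in> {1..K} \<Longrightarrow> d k \<in> W"
    and eq: "\<And>k v. k \<in> {1..K} \<Longrightarrow> v \<in> V \<Longrightarrow>
      inner (z k - z (k - 1)) v + \<tau> * a (z k) v = \<tau> * b (d k) v"
  shows "(\<Sum>k=1..K. ipU (u k - ud k) (d k)) + (\<Sum>k=1..K. ipD (C (y k) - zd k) (C (z k))) = 0"
proof -
  let ?J = "cost ipU ipD C \<tau> K ud zd"
  let ?L = "(\<Sum>k=1..K. ipU (u k - ud k) (d k)) + (\<Sum>k=1..K. ipD (C (y k) - zd k) (C (z k)))"
  let ?Q = "(\<Sum>k=1..K. ipU (d k) (d k)) + (\<Sum>k=1..K. ipD (C (z k)) (C (z k)))"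
  have feas: "feasible V W a b f \<tau> K y0 y u"
    and min: "\<And>y' u'. feasible V W a b f \<tau> K y0 y' u' \<Longrightarrow> ?J y u \<le> ?J y' u'"
    using opt by (auto simp: optimal_def is_arg_min_linorder)
  have yV: "y k \<in> V" if "k \<le> K" for k using feas that by (auto simp: feasible_def)
  have uW: "u k \<in> W" if "k \<in> {1..K}" for k using feas that by (auto simp: feasible_def)
  \<comment> \<open>The right-hand side is the increase of the cost at step \<open>t\<close>;
    \<open>?L\<close> is its slope at 0 and \<open>?Q\<close> its second derivative, up to the
    factor \<open>\<tau>\<close>.\<close>
  have "0 \<le> t * (\<tau> * ?L) + t\<^sup>2 * (\<tau> / 2 * ?Q)" for t
  proof -
    let ?y = "\<lambda>k. y k + t *\<^sub>R z k" and ?u = "\<lambda>k. u k + t *\<^sub>R d k"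
    have "inner (?y k) v + \<tau> * a (?y k) v = inner (?y (k - 1)) v + \<tau> * b (?u k) v + \<tau> * f v"
      if k: "k \<in> {1..K}" and v: "v \<in> V" for k v
    proof -
      have "k \<le> K" "k - 1 \<le> K" using k by auto
      then have "a (?y k) v = a (y k) v + t * a (z k) v" "b (?u k) v = b (u k) v + t * b (d k) v"
        using bilinear_form_on_arith[OF a V V] bilinear_form_on_arith[OF b W V] v yV z(2) uW[OF k] d[OF k]
        by (auto simp: subspace_scale[OF V] subspace_scale[OF W])
      moreover have "t * (inner (z k - z (k - 1)) v + \<tau> * a (z k) v) = t * (\<tau> * b (d k) v)"
        using eq[OF k v] by simp
      moreover have "inner (y k) v + \<tau> * a (y k) v = inner (y (k - 1)) v + \<tau> * b (u k) v + \<tau> * f v"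
        using feas k v by (auto simp: feasible_def)
      ultimately show ?thesis by (simp add: inner_add_left inner_diff_left algebra_simps)
    qed
    then have "feasible V W a b f \<tau> K y0 ?y ?u"
      using feas yV uW z d
      by (auto simp: feasible_def intro!: subspace_add[OF V] subspace_add[OF W] subspace_scale[OF V] subspace_scale[OF W])
    then have "?J y u \<le> ?J ?y ?u" by (rule min)
    moreover have "(ip_norm ipU (?u k - ud k))\<^sup>2 =
        (ip_norm ipU (u k - ud k))\<^sup>2 + (2 * t * ipU (u k - ud k) (d k) + t\<^sup>2 * ipU (d k) (d k))"
      if k: "k \<in> {1..K}" for k
    proof -
      have w: "u k - ud k \<in> W" using uW ud k by (intro subspace_diff[OF W])
      have w': "?u k - ud k = (u k - ud k) + t *\<^sub>R d k" by simp
      have "\<dots> \<in> W" using w d[OF k] by (intro subspace_add[OF W] subspace_scale[OF W])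
      then show ?thesis
        unfolding w' using ip_norm_square(1)[OF ipU W] inner_product_on_expand[OF ipU W w d[OF k]] w by simp
    qed
    moreover have "(ip_norm ipD (C (?y k) - zd k))\<^sup>2 =
        (ip_norm ipD (C (y k) - zd k))\<^sup>2 + (2 * t * ipD (C (y k) - zd k) (C (z k)) + t\<^sup>2 * ipD (C (z k)) (C (z k)))"
      if k: "k \<in> {1..K}" for k
    proof -
      have w: "C (?y k) - zd k = (C (y k) - zd k) + t *\<^sub>R C (z k)" using C yV z(2) k by simp
      show ?thesis
        unfolding w using ip_norm_square(1)[OF ipD] inner_product_on_expand[OF ipD] by simp
    qed
    ultimately have "0 \<le> \<tau> / 2 * (\<Sum>k=1..K. 2 * t * ipU (u k - ud k) (d k) + t\<^sup>2 * ipU (d k) (d k)) +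
        \<tau> / 2 * (\<Sum>k=1..K. 2 * t * ipD (C (y k) - zd k) (C (z k)) + t\<^sup>2 * ipD (C (z k)) (C (z k)))"
      by (simp add: cost_def sum.distrib distrib_left)
    then show ?thesis by (simp add: sum.distrib sum_distrib_left[symmetric] algebra_simps)
  qed
  then have "\<tau> * ?L = 0" by (rule linear_coeff_eq_0)
  then show ?thesis using \<tau> by simp
qed

section \<open>Real inequalities for the final estimate\<close>

lemma weighted_sum_Cauchy_Schwarz:
  fixes x y :: "'i \<Rightarrow> real"
  assumes "\<tau> \<ge> 0"
  shows "\<tau> * (\<Sum>k\<in>I. x k * y k) \<le> sqrt (\<tau> * (\<Sum>k\<in>I. (x k)\<^sup>2)) * sqrt (\<tau> * (\<Sum>k\<in>I. (y k)\<^sup>2))"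
proof -
  have "(\<Sum>k\<in>I. x k * y k) \<le> (\<Sum>k\<in>I. \<bar>x k\<bar> * \<bar>y k\<bar>)"
    by (intro sum_mono) (metis abs_ge_self abs_mult)
  also have "\<dots> \<le> sqrt (\<Sum>k\<in>I. (x k)\<^sup>2) * sqrt (\<Sum>k\<in>I. (y k)\<^sup>2)"
    using L2_set_mult_ineq[of x y I] by (simp add: L2_set_def)
  finally have "\<tau> * (\<Sum>k\<in>I. x k * y k) \<le> \<tau> * (sqrt (\<Sum>k\<in>I. (x k)\<^sup>2) * sqrt (\<Sum>k\<in>I. (y k)\<^sup>2))"
    using assms by (rule mult_left_mono)
  also have "\<dots> = sqrt (\<tau> * (\<Sum>k\<in>I. (x k)\<^sup>2)) * sqrt (\<tau> * (\<Sum>k\<in>I. (y k)\<^sup>2))"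
    using assms by (simp add: real_sqrt_mult mult.left_commute)
  finally show ?thesis .
qed

text \<open>Completing the square gives \<open>(x - c)\<^sup>2 \<le> c\<^sup>2 + d\<close>; this is
  where the shape of the error bound comes from.\<close>

lemma le_quadratic_root:
  fixes x c d :: real
  assumes "x\<^sup>2 \<le> 2 * c * x + d"
  shows "x \<le> c + sqrt (c\<^sup>2 + d)"
proof -
  have "(x - c)\<^sup>2 \<le> c\<^sup>2 + d" using assms by (simp add: power2_eq_square algebra_simps)
  then have "x - c \<le> sqrt (c\<^sup>2 + d)" by (rule real_le_rsqrt)
  then show ?thesis by simp
qed

theorem proposition2:
  fixes \<Omega> :: "(real ^ 'd) set"
    and Ye Y Y\<^sub>N U U\<^sub>N :: "('d::finite) L2 set"
    and ipY ipU :: "'d L2 \<Rightarrow> 'd L2 \<Rightarrow> real"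
    and ipD :: "real ^ 'l \<Rightarrow> real ^ 'l \<Rightarrow> real"
    and D :: "(real ^ 'P) set"
    and T \<tau> :: real and K :: nat
    and b :: "'d L2 \<Rightarrow> 'd L2 \<Rightarrow> real"
    and a :: "real ^ 'P \<Rightarrow> 'd L2 \<Rightarrow> 'd L2 \<Rightarrow> real"
    and Qa :: nat and \<Theta> :: "nat \<Rightarrow> real ^ 'P \<Rightarrow> real" and aq :: "nat \<Rightarrow> 'd L2 \<Rightarrow> 'd L2 \<Rightarrow> real"
    and f :: "'d L2 \<Rightarrow> real" and h :: "'l \<Rightarrow> 'd L2 \<Rightarrow> real" and C :: "'d L2 \<Rightarrow> real ^ 'l"
    and \<alpha>_low :: real and \<alpha>_LB :: "real ^ 'P \<Rightarrow> real" and \<gamma>\<^sub>b \<gamma>\<^sub>c :: real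
    and ud :: "nat \<Rightarrow> 'd L2" and zd :: "nat \<Rightarrow> real ^ 'l" and y0 :: "'d L2"
    and \<mu> :: "real ^ 'P"
    and y u y\<^sub>N p\<^sub>N u\<^sub>N :: "nat \<Rightarrow> 'd L2"
    and Ry Rp Ru c1 c2 :: real
  assumes "bounded_lipschitz_domain \<Omega>"
    and "hilbert_space_on Ye ipY" and "H1_0 \<Omega> \<subseteq> Ye" and "Ye \<subseteq> H1 \<Omega>"
    and "\<exists>c>0. \<exists>c'>0. \<forall>v\<in>Ye. c * H1_norm \<Omega> v \<le> ip_norm ipY v \<and> ip_norm ipY v \<le> c' * H1_norm \<Omega> v"
    and "hilbert_space_on (L2_on \<Omega>) ipU"
    and "finite_dim_subspace Y" and "Y \<subseteq> Ye"
    and "finite_dim_subspace U" and "U \<subseteq> L2_on \<Omega>"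
    and "compact D"
    and "T > 0" and "K \<ge> 1" and "\<tau> = T / real K"
    and "continuous_bilinear_form_on U ipU Y ipY b"
    and "bilinear_form_norm U ipU Y ipY b < \<infinity>"
    and "\<gamma>\<^sub>b = real_of_ereal (bilinear_form_norm U ipU Y ipY b)"
    and "\<forall>\<nu>\<in>D. continuous_bilinear_form_on Y ipY Y ipY (a \<nu>)"
    and "\<alpha>_low > 0" and "\<forall>\<nu>\<in>D. ereal \<alpha>_low \<le> coercivity_constant Y ipY (a \<nu>)"
    and "\<forall>q\<in>{1..Qa}. continuous_on D (\<Theta> q)"
    and "\<forall>q\<in>{1..Qa}. continuous_bilinear_form_on Y ipY Y ipY (aq q)"
    and "\<forall>\<nu>\<in>D. \<forall>w\<in>Y. \<forall>v\<in>Y. a \<nu> w v = (\<Sum>q=1..Qa. \<Theta> q \<nu> * aq q w v)"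
    and "continuous_linear_form_on Y ipY f"
    and "inner_product_on UNIV ipD"
    and "\<forall>i. continuous_linear_form_on Y ipY (h i)"
    and "C = observation h"
    and "\<gamma>\<^sub>c = real_of_ereal (operator_norm Y ipY ipD C)"
    and "\<forall>\<nu>\<in>D. \<alpha>_low \<le> \<alpha>_LB \<nu> \<and> ereal (\<alpha>_LB \<nu>) \<le> coercivity_constant Y ipY (a \<nu>)"
    and "\<forall>k\<in>{1..K}. ud k \<in> U"
    and "subspace Y\<^sub>N" and "Y\<^sub>N \<subseteq> Y" and "subspace U\<^sub>N" and "U\<^sub>N \<subseteq> U" and "y0 \<in> Y\<^sub>N"
    and "\<mu> \<in> D"
    and "optimal Y U (a \<mu>) b f ipU ipD C \<tau> K y0 ud zd y u"
    and "optimal Y\<^sub>N U\<^sub>N (a \<mu>) b f ipU ipD C \<tau> K y0 ud zd y\<^sub>N u\<^sub>N"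
    and "solves_adjoint Y\<^sub>N (a \<mu>) ipD C \<tau> K zd y\<^sub>N p\<^sub>N"
    and "Ry = total_residual Y ipY \<tau> K (state_residual (a \<mu>) b f \<tau> y\<^sub>N u\<^sub>N)"
    and "Rp = total_residual Y ipY \<tau> K (adjoint_residual (a \<mu>) ipD C \<tau> zd y\<^sub>N p\<^sub>N)"
    and "Ru = total_residual U ipU \<tau> K (control_residual b ipU ud u\<^sub>N p\<^sub>N)"
    and "c1 = 1 / 2 * (Ru + sqrt 2 * \<gamma>\<^sub>b / \<alpha>_LB \<mu> * Rp)"
    and "c2 = 2 * sqrt 2 / \<alpha>_LB \<mu> * Ry * Rp + \<gamma>\<^sub>c\<^sup>2 / (2 * (\<alpha>_LB \<mu>)\<^sup>2) * Ry\<^sup>2"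
  shows "sqrt (\<tau> * (\<Sum>k=1..K. (ip_norm ipU (u k - u\<^sub>N k))\<^sup>2)) \<le> c1 + sqrt (c1\<^sup>2 + c2)"
proof -

  \<comment> \<open>The data on the full-order spaces\<close>
  define \<alpha> where "\<alpha> = \<alpha>_LB \<mu>"
  define A where "A = a \<mu>"
  note Y = assms(7)
  note sY = finite_dim_subspace_subspace[OF Y]
  note sU = finite_dim_subspace_subspace[OF assms(9)]
  have ipY: "inner_product_on Y ipY"
    using assms(2,8) inner_product_on_mono unfolding hilbert_space_on_def by blast
  have ipU: "inner_product_on U ipU"
    using assms(6,10) inner_product_on_mono unfolding hilbert_space_on_def by blast
  note ipD = assms(25)
  have \<tau>: "\<tau> > 0" using assms(12-14) by simp
  have bilb: "bilinear_form_on U Y b" using assms(15) by (simp add: continuous_bilinear_form_on_def)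
  have bilA: "bilinear_form_on Y Y A"
    using assms(18,36) by (simp add: continuous_bilinear_form_on_def A_def)
  have linf: "linear_form_on Y f" using assms(24) by (simp add: continuous_linear_form_on_def)
  have linh: "linear_form_on Y (h i)" for i using assms(26) by (simp add: continuous_linear_form_on_def)
  have bilU: "bilinear_form_on U U ipU" using ipU by (simp add: inner_product_on_def)
  have bilD: "bilinear_form_on UNIV UNIV ipD" using ipD by (simp add: inner_product_on_def)
  note linb = bilinear_form_on_arith[OF bilb sU sY] and linA = bilinear_form_on_arith[OF bilA sY sY]
    and linU = bilinear_form_on_arith[OF bilU sU sU]
    and linD = bilinear_form_on_arith[OF bilD subspace_UNIV subspace_UNIV, simplified]
  note linC = observation_linear[where h = h, OF linh sY, folded assms(27)]
  have \<alpha>: "\<alpha> > 0" using assms(19,29,36) unfolding \<alpha>_def by (meson less_le_trans)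
  have coer: "\<alpha> * (ip_norm ipY v)\<^sup>2 \<le> A v v" if "v \<in> Y" for v
    using coercivity_constant_le[OF ipY sY bilA _ that] assms(29,36) by (simp add: \<alpha>_def A_def)
  have A_nonneg: "A v v \<ge> 0" if "v \<in> Y" for v
    using coer[OF that] \<alpha> by (smt (verit) mult_nonneg_nonneg zero_le_power2)

  have y: "y k \<in> Y" "y\<^sub>N k \<in> Y" if "k \<le> K" for k
    using assms(32,37,38) that by (auto simp: optimal_def is_arg_min_linorder feasible_def)
  have u: "u k \<in> U" "u\<^sub>N k \<in> U" if "k \<in> {1..K}" for k
    using assms(34,37,38) that by (auto simp: optimal_def is_arg_min_linorder feasible_def)
  have pK: "p\<^sub>N (K + 1) = 0" and p: "k \<in> {1..K} \<Longrightarrow> p\<^sub>N k \<in> Y" for k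
    using assms(32,39) by (auto simp: solves_adjoint_def)
  have p': "p\<^sub>N (k + 1) \<in> Y" if "k \<in> {1..K}" for k
    using p[of "k + 1"] pK that subspace_0[OF sY] by (cases "k = K") auto
  \<comment> \<open>The initial condition makes \<open>w 0\<close> the orthogonal projection of
    \<open>y0\<close> onto \<open>V\<close>, which is \<open>y0\<close> itself when
    \<open>y0\<close> lies in \<open>V\<close>. Hence the full and reduced states start equal, and
    \<open>\<eta> 0 = 0\<close> below.\<close>
  have init: "w 0 = y0" if "optimal V W A b f ipU ipD C \<tau> K y0 ud zd w c" "subspace V" "y0 \<in> V" for V W w c
  proof -
    have "w 0 \<in> V" "\<forall>v\<in>V. inner (w 0) v = inner y0 v"
      using that by (auto simp: optimal_def is_arg_min_linorder feasible_def)
    then have "inner (w 0 - y0) (w 0 - y0) = 0"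
      using subspace_diff[OF that(2) _ that(3)] by (simp add: inner_diff_left)
    then show ?thesis by simp
  qed
  have y0: "y 0 = y\<^sub>N 0"
    using init[of Y U y u] init[of Y\<^sub>N U\<^sub>N y\<^sub>N u\<^sub>N] assms(31,32,35,37,38) sY by (auto simp: A_def)
  have state: "inner (y k) v + \<tau> * A (y k) v = inner (y (k - 1)) v + \<tau> * b (u k) v + \<tau> * f v"
    if "k \<in> {1..K}" "v \<in> Y" for k v
    using assms(37) that by (auto simp: optimal_def is_arg_min_linorder feasible_def A_def)

  \<comment> \<open>The state driven by the control error, and the remainder\<close>
  \<comment> \<open>Extension by 0 puts \<open>e k\<close> in \<open>U\<close> for every
    \<open>k\<close>, as the infinite Euler sequence \<open>z\<close> requires.\<close>
  define e where "e k = (if k \<in> {1..K} then u k - u\<^sub>N k else 0)" for k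
  have e: "e k \<in> U" for k using u by (auto simp: e_def intro: subspace_diff[OF sU] subspace_0[OF sU])
  obtain z where z: "z 0 = 0" "\<And>k. z k \<in> Y"
    and z_Suc: "\<And>k v. v \<in> Y \<Longrightarrow> inner (z (Suc k) - z k) v + \<tau> * A (z (Suc k)) v = \<tau> * b (e (Suc k)) v"
    using implicit_Euler_solvable[OF Y bilA \<tau> A_nonneg, of "\<lambda>k. b (e k)"]
      bilinear_form_onD(1)[OF bilb e] by blast
  have z_eq: "inner (z k - z (k - 1)) v + \<tau> * A (z k) v = \<tau> * b (e k) v"
    if "k \<in> {1..K}" "v \<in> Y" for k v
    using z_Suc[of v "k - 1"] that by simp
  define \<eta> where "\<eta> k = y k - y\<^sub>N k - z k" for k
  have \<eta>: "\<eta> 0 = 0" "k \<le> K \<Longrightarrow> \<eta> k \<in> Y" for k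
    using y z y0 by (auto simp: \<eta>_def intro!: subspace_diff[OF sY])

  \<comment> \<open>Bounds of the residuals by their dual norms\<close>
  let ?ry = "state_residual A b f \<tau> y\<^sub>N u\<^sub>N" and ?rp = "adjoint_residual A ipD C \<tau> zd y\<^sub>N p\<^sub>N"
    and ?ru = "control_residual b ipU ud u\<^sub>N p\<^sub>N"
  let ?dy = "\<lambda>k. real_of_ereal (dual_norm Y ipY (?ry k))"
    and ?dp = "\<lambda>k. real_of_ereal (dual_norm Y ipY (?rp k))"
    and ?du = "\<lambda>k. real_of_ereal (dual_norm U ipU (?ru k))"
  have R: "Ry = sqrt (\<tau> * (\<Sum>k=1..K. (?dy k)\<^sup>2))" "Rp = sqrt (\<tau> * (\<Sum>k=1..K. (?dp k)\<^sup>2))"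
    "Ru = sqrt (\<tau> * (\<Sum>k=1..K. (?du k)\<^sup>2))"
    using assms(40-42) by (simp_all add: total_residual_def A_def)
  have R_nonneg: "Ry \<ge> 0" "Rp \<ge> 0" using \<tau> by (auto simp: R intro!: mult_nonneg_nonneg sum_nonneg)

  have "linear_form_on Y (?ry k)" if "k \<in> {1..K}" for k
  proof -
    have "y\<^sub>N k \<in> Y" "u\<^sub>N k \<in> U" using y u that by auto
    then show ?thesis
      unfolding linear_form_on_def state_residual_def
      by (auto simp: linb linA linear_form_onD[OF linf sY] inner_add_right algebra_simps)
  qed
  then have ry: "?ry k v \<le> ?dy k * ip_norm ipY v" if "k \<in> {1..K}" "v \<in> Y" for k v
    using abs_le_dual_norm[OF Y ipY, of "?ry k" v] that by auto
  have "linear_form_on Y (?rp k)" if "k \<in> {1..K}" for k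
    unfolding linear_form_on_def adjoint_residual_def
    using p[OF that] by (auto simp: linA linC linD inner_add_left algebra_simps)
  then have rp: "?rp k v \<le> ?dp k * ip_norm ipY v" if "k \<in> {1..K}" "v \<in> Y" for k v
    using abs_le_dual_norm[OF Y ipY, of "?rp k" v] that by auto
  have "linear_form_on U (?ru k)" if "k \<in> {1..K}" for k
  proof -
    have "u\<^sub>N k - ud k \<in> U" using u assms(30) that by (auto intro: subspace_diff[OF sU])
    then show ?thesis
      unfolding linear_form_on_def control_residual_def
      using p[OF that] by (auto simp: linb linU algebra_simps)
  qed
  then have ru: "?ru k v \<le> ?du k * ip_norm ipU v" if "k \<in> {1..K}" "v \<in> U" for k v
    using abs_le_dual_norm[OF assms(9) ipU, of "?ru k" v] that by auto

  \<comment> \<open>Energy bounds for \<open>z\<close> and \<open>\<eta>\<close>\<close>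
  note b_le = abs_le_bilinear_form_norm[OF sU ipU sY ipY bilb assms(16), folded assms(17)]
  note \<gamma>\<^sub>b = bilinear_form_norm_nonneg[OF sU ipU sY ipY bilb assms(16), folded assms(17)]
  have z_bound: "\<alpha>\<^sup>2 * (\<Sum>k=1..K. (ip_norm ipY (z k))\<^sup>2) \<le> (\<Sum>k=1..K. (\<gamma>\<^sub>b * ip_norm ipU (e k))\<^sup>2)"
    by (rule energy_estimate[where z = z and A = "\<lambda>k. A (z k) (z k)" and g = "\<lambda>k. b (e k) (z k)", OF \<tau> \<alpha> z(1)])
      (use z z_eq coer b_le[OF e z(2)] in \<open>auto intro: order_trans[OF abs_ge_self]\<close>)
  \<comment> \<open>Subtracting the equation of \<open>z\<close> cancels the control error, so only
    the state residual drives \<open>\<eta>\<close>.\<close>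
  have \<eta>_eq: "inner (\<eta> k - \<eta> (k - 1)) v + \<tau> * A (\<eta> k) v = \<tau> * ?ry k v"
    if k: "k \<in> {1..K}" and v: "v \<in> Y" for k v
  proof -
    have kK: "k \<le> K" using k by simp
    have "A (\<eta> k) v = A (y k) v - A (y\<^sub>N k) v - A (z k) v"
      using y kK z v by (simp add: \<eta>_def linA subspace_diff[OF sY])
    then have "\<tau> * A (\<eta> k) v = \<tau> * A (y k) v - \<tau> * A (y\<^sub>N k) v - \<tau> * A (z k) v"
      by (simp add: right_diff_distrib)
    moreover have "b (e k) v = b (u k) v - b (u\<^sub>N k) v" using k u[OF k] v by (simp add: e_def linb)
    then have "\<tau> * b (e k) v = \<tau> * b (u k) v - \<tau> * b (u\<^sub>N k) v" by (simp add: right_diff_distrib)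
    moreover have "\<tau> * ?ry k v =
        \<tau> * f v + \<tau> * b (u\<^sub>N k) v - \<tau> * A (y\<^sub>N k) v - inner (y\<^sub>N k - y\<^sub>N (k - 1)) v"
      using \<tau> by (simp add: state_residual_def algebra_simps)
    moreover have "inner (\<eta> k - \<eta> (k - 1)) v =
        inner (y k) v - inner (y (k - 1)) v - inner (y\<^sub>N k - y\<^sub>N (k - 1)) v - inner (z k - z (k - 1)) v"
      by (simp add: \<eta>_def inner_diff_left)
    ultimately show ?thesis using state[OF k v] z_eq[OF k v] by linarith
  qed
  have \<eta>_bound: "\<alpha>\<^sup>2 * (\<Sum>k=1..K. (ip_norm ipY (\<eta> k))\<^sup>2) \<le> (\<Sum>k=1..K. (?dy k)\<^sup>2)"
    by (rule energy_estimate[where z = \<eta> and A = "\<lambda>k. A (\<eta> k) (\<eta> k)" and g = "\<lambda>k. ?ry k (\<eta> k)", OF \<tau> \<alpha> \<eta>(1)])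
      (use coer ry \<eta>(2) \<eta>_eq in auto)

  \<comment> \<open>The error inequality from optimality and the reduced adjoint\<close>
  have C_lin: "C (v + t *\<^sub>R w) = C v + t *\<^sub>R C w" if "v \<in> Y" "w \<in> Y" for v w t
    using linC that subspace_scale[OF sY] by simp
  have var: "(\<Sum>k=1..K. ipU (u k - ud k) (e k)) + (\<Sum>k=1..K. ipD (C (y k) - zd k) (C (z k))) = 0"
    by (rule optimal_variational_equation[OF assms(37)[folded A_def] \<tau> sY sU bilA bilb ipU ipD C_lin])
      (use assms(30) z z_eq e in auto)
  \<comment> \<open>The reduced adjoint is an admissible test function for \<open>z\<close> because
    it lies in \<open>Y\<close>. Summation by parts then produces the terms occurring in the adjoint
    residual at \<open>z k\<close>.\<close>
  have "(\<Sum>k=1..K. \<tau> * b (e k) (p\<^sub>N k)) =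
      (\<Sum>k=1..K. inner (z k - z (k - 1)) (p\<^sub>N k) + \<tau> * A (z k) (p\<^sub>N k))"
    using z_eq p by (intro sum.cong refl) metis
  also have "\<dots> = (\<Sum>k=1..K. inner (z k) (p\<^sub>N k - p\<^sub>N (k + 1))) + (\<Sum>k=1..K. \<tau> * A (z k) (p\<^sub>N k))"
    using discrete_summation_by_parts[of z p\<^sub>N K] pK z(1) by (simp add: sum.distrib)
  finally have "\<tau> * (\<Sum>k=1..K. b (e k) (p\<^sub>N k)) =
      \<tau> * ((\<Sum>k=1..K. 1 / \<tau> * inner (z k) (p\<^sub>N k - p\<^sub>N (k + 1))) + (\<Sum>k=1..K. A (z k) (p\<^sub>N k)))"
    using \<tau> by (simp add: distrib_left sum_distrib_left)
  then have sum_b: "(\<Sum>k=1..K. b (e k) (p\<^sub>N k)) =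
      (\<Sum>k=1..K. 1 / \<tau> * inner (z k) (p\<^sub>N k - p\<^sub>N (k + 1))) + (\<Sum>k=1..K. A (z k) (p\<^sub>N k))"
    using \<tau> by simp
  \<comment> \<open>The terms are grouped so that, after summation over \<open>k\<close>, the first
    two cancel by \<open>var\<close> and the last group by \<open>sum_b\<close>. What remains are
    the two residuals and the observation of \<open>\<eta>\<close>.\<close>
  have "ipU (e k) (e k) \<le> ipU (u k - ud k) (e k) + ipD (C (y k) - zd k) (C (z k))
      + (?ru k (e k) + ?rp k (z k) + 1 / 4 * ipD (C (\<eta> k)) (C (\<eta> k)))
      - (b (e k) (p\<^sub>N k) - 1 / \<tau> * inner (z k) (p\<^sub>N k - p\<^sub>N (k + 1)) - A (z k) (p\<^sub>N k))"
    if k: "k \<in> {1..K}" for k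
  proof -
    have kK: "k \<le> K" using k by simp
    have "ipU (e k) (e k) = ipU (u k - ud k) (e k) - ipU (u\<^sub>N k - ud k) (e k)"
      using linU(2)[of "u k - ud k" "u\<^sub>N k - ud k" "e k"] u[OF k] assms(30) k e
      by (simp add: e_def subspace_diff[OF sU])
    moreover have "C (y k) = C (y\<^sub>N k) + C (z k) + C (\<eta> k)"
      using linC(1)[of "y\<^sub>N k + z k" "\<eta> k"] linC(1)[of "y\<^sub>N k" "z k"] y[OF kK] z \<eta>(2)[OF kK]
      by (simp add: \<eta>_def subspace_add[OF sY])
    then have "ipD (C (y k) - zd k) (C (z k)) = - ipD (zd k - C (y\<^sub>N k)) (C (z k))
        + ipD (C (z k)) (C (z k)) + ipD (C (\<eta> k)) (C (z k))"
      by (simp add: linD)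
    \<comment> \<open>Completing the square absorbs the mixed term of \<open>z\<close> and
      \<open>\<eta>\<close> into the observation of \<open>z\<close>, at the price of a quarter of
      the squared norm of \<open>C (\<eta> k)\<close>.\<close>
    moreover have "0 \<le> ipD (C (z k) + (1 / 2) *\<^sub>R C (\<eta> k)) (C (z k) + (1 / 2) *\<^sub>R C (\<eta> k))"
      by (rule inner_product_on_nonneg[OF ipD]) auto
    then have "0 \<le> ipD (C (z k)) (C (z k)) + ipD (C (z k)) (C (\<eta> k)) + 1 / 4 * ipD (C (\<eta> k)) (C (\<eta> k))"
      by (simp add: inner_product_on_expand[OF ipD] power2_eq_square)
    moreover have "ipD (C (\<eta> k)) (C (z k)) = ipD (C (z k)) (C (\<eta> k))"
      using ipD by (simp add: inner_product_on_def)
    ultimately show ?thesis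
      unfolding control_residual_def adjoint_residual_def by linarith
  qed
  then have "(\<Sum>k=1..K. ipU (e k) (e k)) \<le> (\<Sum>k=1..K. ipU (u k - ud k) (e k) + ipD (C (y k) - zd k) (C (z k))
      + (?ru k (e k) + ?rp k (z k) + 1 / 4 * ipD (C (\<eta> k)) (C (\<eta> k)))
      - (b (e k) (p\<^sub>N k) - 1 / \<tau> * inner (z k) (p\<^sub>N k - p\<^sub>N (k + 1)) - A (z k) (p\<^sub>N k)))"
    by (rule sum_mono)
  also have "\<dots> = (\<Sum>k=1..K. ?ru k (e k) + ?rp k (z k) + 1 / 4 * ipD (C (\<eta> k)) (C (\<eta> k)))"
    using var sum_b by (simp add: sum.distrib sum_subtractf)
  also have "\<dots> \<le> (\<Sum>k=1..K. ?du k * ip_norm ipU (e k) + ?dp k * ip_norm ipY (z k)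
      + \<gamma>\<^sub>c\<^sup>2 / 4 * (ip_norm ipY (\<eta> k))\<^sup>2)"
  proof (intro sum_mono add_mono)
    fix k assume k: "k \<in> {1..K}"
    then have \<eta>k: "\<eta> k \<in> Y" using \<eta>(2) by simp
    show "?ru k (e k) \<le> ?du k * ip_norm ipU (e k)" using ru[OF k e] .
    show "?rp k (z k) \<le> ?dp k * ip_norm ipY (z k)" using rp[OF k z(2)] .
    have "ip_norm ipD (C (\<eta> k)) \<le> \<gamma>\<^sub>c * ip_norm ipY (\<eta> k)"
      using ip_norm_observation_le[OF Y ipY linh ipD \<eta>k] by (simp add: assms(27,28))
    then have "(ip_norm ipD (C (\<eta> k)))\<^sup>2 \<le> (\<gamma>\<^sub>c * ip_norm ipY (\<eta> k))\<^sup>2"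
      using ip_norm_square(2)[OF ipD] by (intro power_mono) auto
    then show "1 / 4 * ipD (C (\<eta> k)) (C (\<eta> k)) \<le> \<gamma>\<^sub>c\<^sup>2 / 4 * (ip_norm ipY (\<eta> k))\<^sup>2"
      using ip_norm_square(1)[OF ipD] by (simp add: power_mult_distrib)
  qed
  finally have main: "(\<Sum>k=1..K. ipU (e k) (e k)) \<le> (\<Sum>k=1..K. ?du k * ip_norm ipU (e k))
      + (\<Sum>k=1..K. ?dp k * ip_norm ipY (z k)) + \<gamma>\<^sub>c\<^sup>2 / 4 * (\<Sum>k=1..K. (ip_norm ipY (\<eta> k))\<^sup>2)"
    by (simp add: sum.distrib sum_distrib_left)

  \<comment> \<open>The quadratic inequality for the control error\<close>
  define X where "X = sqrt (\<tau> * (\<Sum>k=1..K. (ip_norm ipU (e k))\<^sup>2))"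
  define Z where "Z = sqrt (\<tau> * (\<Sum>k=1..K. (ip_norm ipY (z k))\<^sup>2))"
  have X: "X \<ge> 0" "X\<^sup>2 = \<tau> * (\<Sum>k=1..K. (ip_norm ipU (e k))\<^sup>2)"
    using \<tau> by (auto simp: X_def intro!: mult_nonneg_nonneg sum_nonneg)
  have Ry2: "Ry\<^sup>2 = \<tau> * (\<Sum>k=1..K. (?dy k)\<^sup>2)"
    using \<tau> unfolding R by (auto intro!: mult_nonneg_nonneg sum_nonneg)
  have "(\<alpha> * Z)\<^sup>2 = \<tau> * (\<alpha>\<^sup>2 * (\<Sum>k=1..K. (ip_norm ipY (z k))\<^sup>2))"
    using \<tau> by (simp add: Z_def power_mult_distrib sum_nonneg)
  also have "\<dots> \<le> \<tau> * (\<Sum>k=1..K. (\<gamma>\<^sub>b * ip_norm ipU (e k))\<^sup>2)"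
    using z_bound \<tau> by (intro mult_left_mono) auto
  also have "\<dots> = (\<gamma>\<^sub>b * X)\<^sup>2" by (simp add: power_mult_distrib X(2) sum_distrib_left mult_ac)
  finally have "\<alpha> * Z \<le> \<gamma>\<^sub>b * X" by (rule power2_le_imp_le) (use \<gamma>\<^sub>b X in simp)
  then have Z: "Z \<le> \<gamma>\<^sub>b / \<alpha> * X" using \<alpha> by (simp add: field_simps)
  have H: "\<tau> * (\<Sum>k=1..K. (ip_norm ipY (\<eta> k))\<^sup>2) \<le> Ry\<^sup>2 / \<alpha>\<^sup>2"
    using mult_left_mono[OF \<eta>_bound, of \<tau>] \<tau> \<alpha> by (simp add: Ry2 field_simps)
  have "X\<^sup>2 = \<tau> * (\<Sum>k=1..K. ipU (e k) (e k))"
    using ip_norm_square(1)[OF ipU sU e] by (simp add: X(2))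
  also have "\<dots> \<le> \<tau> * (\<Sum>k=1..K. ?du k * ip_norm ipU (e k)) + \<tau> * (\<Sum>k=1..K. ?dp k * ip_norm ipY (z k))
      + \<gamma>\<^sub>c\<^sup>2 / 4 * (\<tau> * (\<Sum>k=1..K. (ip_norm ipY (\<eta> k))\<^sup>2))"
    using mult_left_mono[OF main, of \<tau>] \<tau> by (simp add: algebra_simps)
  also have "\<dots> \<le> Ru * X + Rp * Z + \<gamma>\<^sub>c\<^sup>2 / 4 * (Ry\<^sup>2 / \<alpha>\<^sup>2)"
    unfolding R(2,3) X_def Z_def
    using \<tau> H by (intro add_mono weighted_sum_Cauchy_Schwarz mult_left_mono) auto
  also have "\<dots> \<le> 2 * c1 * X + c2"
  proof -
    \<comment> \<open>Three enlargements lead to \<open>c1\<close> and \<open>c2\<close>: the factor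
      1 at \<open>Rp\<close> grows to \<open>sqrt 2\<close>, the factor 1/4 at
      \<open>Ry\<^sup>2\<close> to 1/2, and a nonnegative mixed term in \<open>Ry\<close> and
      \<open>Rp\<close> is added.\<close>
    have "Rp * Z \<le> Rp * (\<gamma>\<^sub>b / \<alpha> * X)" using Z R_nonneg(2) by (rule mult_left_mono)
    also have "\<dots> \<le> sqrt 2 * (Rp * (\<gamma>\<^sub>b / \<alpha> * X))"
      using R_nonneg(2) \<gamma>\<^sub>b \<alpha> X(1) mult_right_mono[of 1 "sqrt 2" "Rp * (\<gamma>\<^sub>b / \<alpha> * X)"] by simp
    finally have "Ru * X + Rp * Z \<le> 2 * c1 * X"
      by (simp add: assms(43) \<alpha>_def algebra_simps)
    moreover have "\<gamma>\<^sub>c\<^sup>2 / 4 * (Ry\<^sup>2 / \<alpha>\<^sup>2) \<le> \<gamma>\<^sub>c\<^sup>2 / 2 * (Ry\<^sup>2 / \<alpha>\<^sup>2)"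
      by (intro mult_right_mono) auto
    moreover have "0 \<le> 2 * sqrt 2 / \<alpha> * Ry * Rp" using R_nonneg \<alpha> by simp
    ultimately show ?thesis by (simp add: assms(44) \<alpha>_def)
  qed
  finally have "X \<le> c1 + sqrt (c1\<^sup>2 + c2)" by (rule le_quadratic_root)
  moreover have "X = sqrt (\<tau> * (\<Sum>k=1..K. (ip_norm ipU (u k - u\<^sub>N k))\<^sup>2))"
    by (simp add: X_def e_def)
  ultimately show ?thesis by simp
qed

end
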